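(* Let $(R,\mathfrak m)$ be a two-dimensional regular local ring with infinite residue field. Suppose that $I$ is an integrally closed ideal of $R$ of order $r$ and that the image of $I$ in $\mathfrak m^r/\mathfrak m^{r+1}$ is at least $2$-dimensional as a vector space over $R/\mathfrak m$. If $I=I(M)$ is the ideal of minors of an integrally closed $R$-module $M$ of rank $r$ without free direct summands, then $\mathfrak m$ is a direct summand of $M$ (that is, $M\cong \mathfrak m\oplus N$ for some $R$-module $N$).
   Context: Modules are finitely generated torsion-free $R$-modules. For such an $M$ of rank $r$, let $F=M^{**}$ (double $R$-dual), a free $R$-module of rank $r$ containing $M$; identify $F$ with $R^r$ and regard $M$ as the submodule generated by the columns of a matrix with $r$ rows. The ideal of minors $I(M)$ is the ideal of $R$ generated by the $r\times r$ minors of this matrix. With $\mathcal K$ the fraction field of $R$, an element $v\in F$ is integral over $M$ if $v\in MV$ (the $V$-span of $M$ in $F\otimes_R \mathcal K$) for every discrete valuation ring $V$ with $R\subseteq V\subseteq \mathcal K$; $M$ is integrally closed if it contains every element of $F$ integral over it. "Without free direct summands" means without nonzero free direct summands. The order of an ideal $I$ is the largest $k$ with $I\subseteq\mathfrak m^k$. *)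

theory Defs
  imports
    "HOL-Library.Function_Algebras"
    "HOL-Library.Product_Plus"
    "HOL-Computational_Algebra.Polynomial_Factorial"
    "Jordan_Normal_Form.Determinant"
    "Jordan_Normal_Form.DL_Submatrix"
begin

section \<open>Ideals of a commutative ring\<close>

text \<open>The ring is a type of class \<open>comm_ring_1\<close> (later \<open>idom\<close>). Its ideals are its submodules as
  a module over itself. The names are qualified because the Matrix theories also load the
  record-based locale \<open>module\<close> of HOL-Algebra.\<close>

lemma module_mult: "Modules.module ((*) :: 'a::comm_ring_1 \<Rightarrow> 'a \<Rightarrow> 'a)"
  by unfold_locales (simp_all add: algebra_simps)

abbreviation is_ideal :: "'a::comm_ring_1 set \<Rightarrow> bool" where
  "is_ideal \<equiv> Modules.module.subspace (*)"

abbreviation ideal_gen :: "'a::comm_ring_1 set \<Rightarrow> 'a set" where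
  "ideal_gen \<equiv> Modules.module.span (*)"

definition is_prime_ideal :: "'a::comm_ring_1 set \<Rightarrow> bool" where
  "is_prime_ideal P \<longleftrightarrow> is_ideal P \<and> P \<noteq> UNIV \<and> (\<forall>x y. x * y \<in> P \<longrightarrow> x \<in> P \<or> y \<in> P)"

definition is_maximal_ideal :: "'a::comm_ring_1 set \<Rightarrow> bool" where
  "is_maximal_ideal P \<longleftrightarrow>
     is_ideal P \<and> P \<noteq> UNIV \<and> (\<forall>J. is_ideal J \<and> P \<subseteq> J \<longrightarrow> J = P \<or> J = UNIV)"

fun ideal_power :: "'a::comm_ring_1 set \<Rightarrow> nat \<Rightarrow> 'a set" where
  "ideal_power I 0 = UNIV"
| "ideal_power I (Suc n) = ideal_gen {x * y |x y. x \<in> I \<and> y \<in> ideal_power I n}"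

section \<open>Regular local rings\<close>

definition noetherian :: "'a::comm_ring_1 itself \<Rightarrow> bool" where
  "noetherian TYPE('a) \<longleftrightarrow> (\<forall>I :: 'a set. is_ideal I \<longrightarrow> (\<exists>S. finite S \<and> ideal_gen S = I))"

definition prime_chain :: "nat \<Rightarrow> (nat \<Rightarrow> 'a::comm_ring_1 set) \<Rightarrow> bool" where
  "prime_chain n P \<longleftrightarrow> (\<forall>i\<le>n. is_prime_ideal (P i)) \<and> (\<forall>i<n. P i \<subset> P (Suc i))"

definition has_krull_dim :: "'a::comm_ring_1 itself \<Rightarrow> nat \<Rightarrow> bool" where
  "has_krull_dim TYPE('a) d \<longleftrightarrow>
     (\<exists>P :: nat \<Rightarrow> 'a set. prime_chain d P) \<and>
     (\<forall>n. \<forall>P :: nat \<Rightarrow> 'a set. prime_chain n P \<longrightarrow> n \<le> d)"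

definition local_ring :: "'a::comm_ring_1 set \<Rightarrow> bool" where
  "local_ring \<mm> \<longleftrightarrow> is_maximal_ideal \<mm> \<and> (\<forall>P. is_maximal_ideal P \<longrightarrow> P = \<mm>)"

definition regular_local_ring :: "'a::comm_ring_1 set \<Rightarrow> nat \<Rightarrow> bool" where
  "regular_local_ring \<mm> d \<longleftrightarrow>
     noetherian TYPE('a) \<and> local_ring \<mm> \<and> has_krull_dim TYPE('a) d \<and>
     (\<exists>S. finite S \<and> card S = d \<and> ideal_gen S = \<mm>)"

definition residue_ring :: "'a::comm_ring_1 set \<Rightarrow> 'a set set" where
  "residue_ring \<mm> = UNIV // {(x, y). x - y \<in> \<mm>}"

section \<open>Order, initial forms and integral closure of an ideal\<close>

definition has_ideal_order :: "'a::comm_ring_1 set \<Rightarrow> 'a set \<Rightarrow> nat \<Rightarrow> bool" where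
  "has_ideal_order \<mm> I r \<longleftrightarrow>
     I \<subseteq> ideal_power \<mm> r \<and> (\<forall>k. I \<subseteq> ideal_power \<mm> k \<longrightarrow> k \<le> r)"

text \<open>The image of \<open>I\<close> in \<open>P/J\<close>, where \<open>I \<subseteq> P\<close> and \<open>\<mm>P \<subseteq> J\<close>, has dimension \<open>d\<close> over \<open>R/\<mm>\<close>:
  the classes of \<open>v 0, \<dots>, v (d - 1)\<close> form a basis of it. Scalars in \<open>R/\<mm>\<close> and vectors in \<open>P/J\<close>
  are given by representatives in \<open>R\<close>; the condition does not depend on \<open>P\<close>.\<close>

definition image_has_dim :: "'a::comm_ring_1 set \<Rightarrow> 'a set \<Rightarrow> 'a set \<Rightarrow> nat \<Rightarrow> bool" where
  "image_has_dim \<mm> J I d \<longleftrightarrow>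
     (\<exists>v :: nat \<Rightarrow> 'a.
        (\<forall>i<d. v i \<in> I) \<and>
        (\<forall>c. (\<Sum>i<d. c i * v i) \<in> J \<longrightarrow> (\<forall>i<d. c i \<in> \<mm>)) \<and>
        (\<forall>x\<in>I. \<exists>c. x - (\<Sum>i<d. c i * v i) \<in> J))"

definition integral_over_ideal :: "'a::comm_ring_1 set \<Rightarrow> 'a \<Rightarrow> bool" where
  "integral_over_ideal I x \<longleftrightarrow>
     (\<exists>n>0. \<exists>a :: nat \<Rightarrow> 'a. (\<forall>i\<in>{1..n}. a i \<in> ideal_power I i) \<and>
        x ^ n + (\<Sum>i=1..n. a i * x ^ (n - i)) = 0)"

definition integrally_closed_ideal :: "'a::comm_ring_1 set \<Rightarrow> bool" where
  "integrally_closed_ideal I \<longleftrightarrow> is_ideal I \<and> (\<forall>x. integral_over_ideal I x \<longrightarrow> x \<in> I)"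

section \<open>Modules\<close>

text \<open>An \<open>R\<close>-module \<open>M\<close> is a type with a scalar multiplication satisfying \<open>Modules.module\<close>.\<close>

definition finitely_generated :: "('a::comm_ring_1 \<Rightarrow> 'm::ab_group_add \<Rightarrow> 'm) \<Rightarrow> bool" where
  "finitely_generated scale \<longleftrightarrow> (\<exists>S. finite S \<and> Modules.module.span scale S = UNIV)"

definition torsion_free :: "('a::comm_ring_1 \<Rightarrow> 'm::ab_group_add \<Rightarrow> 'm) \<Rightarrow> bool" where
  "torsion_free scale \<longleftrightarrow> (\<forall>c x. scale c x = 0 \<longrightarrow> c = 0 \<or> x = 0)"

definition has_rank :: "('a::comm_ring_1 \<Rightarrow> 'm::ab_group_add \<Rightarrow> 'm) \<Rightarrow> nat \<Rightarrow> bool" where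
  "has_rank scale r \<longleftrightarrow>
     (\<exists>B. finite B \<and> card B = r \<and> \<not> Modules.module.dependent scale B) \<and>
     (\<forall>B. finite B \<and> \<not> Modules.module.dependent scale B \<longrightarrow> card B \<le> r)"

definition free_submodule :: "('a::comm_ring_1 \<Rightarrow> 'm::ab_group_add \<Rightarrow> 'm) \<Rightarrow> 'm set \<Rightarrow> bool" where
  "free_submodule scale A \<longleftrightarrow>
     (\<exists>B. \<not> Modules.module.dependent scale B \<and> Modules.module.span scale B = A)"

definition internal_direct_sum ::
  "('a::comm_ring_1 \<Rightarrow> 'm::ab_group_add \<Rightarrow> 'm) \<Rightarrow> 'm set \<Rightarrow> 'm set \<Rightarrow> bool" where
  "internal_direct_sum scale A N \<longleftrightarrow>
     Modules.module.subspace scale A \<and> Modules.module.subspace scale N \<and>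
     A \<inter> N = {0} \<and> {a + n |a n. a \<in> A \<and> n \<in> N} = UNIV"

definition without_free_summands :: "('a::comm_ring_1 \<Rightarrow> 'm::ab_group_add \<Rightarrow> 'm) \<Rightarrow> bool" where
  "without_free_summands scale \<longleftrightarrow>
     \<not> (\<exists>A N. internal_direct_sum scale A N \<and> free_submodule scale A \<and> A \<noteq> {0})"

text \<open>Linear isomorphisms between carrier sets; only \<open>plus\<close> is required so that \<open>'a vec\<close>,
  which is not an additive group as a type, is covered.\<close>

definition linear_iso ::
  "('a \<Rightarrow> 'b::plus \<Rightarrow> 'b) \<Rightarrow> 'b set \<Rightarrow> ('a \<Rightarrow> 'c::plus \<Rightarrow> 'c) \<Rightarrow> 'c set \<Rightarrow> ('b \<Rightarrow> 'c) \<Rightarrow> bool" where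
  "linear_iso sA A sB B f \<longleftrightarrow>
     bij_betw f A B \<and>
     (\<forall>x\<in>A. \<forall>y\<in>A. f (x + y) = f x + f y) \<and>
     (\<forall>c. \<forall>x\<in>A. f (sA c x) = sB c (f x))"

definition prod_scale :: "('a \<Rightarrow> 'b \<Rightarrow> 'b) \<Rightarrow> ('a \<Rightarrow> 'c \<Rightarrow> 'c) \<Rightarrow> 'a \<Rightarrow> 'b \<times> 'c \<Rightarrow> 'b \<times> 'c" where
  "prod_scale sA sB c x = (sA c (fst x), sB c (snd x))"

section \<open>The double dual\<close>

definition dual :: "('a::comm_ring_1 \<Rightarrow> 'm::ab_group_add \<Rightarrow> 'm) \<Rightarrow> ('m \<Rightarrow> 'a) set" where
  "dual scale = {f. Modules.module_hom scale (*) f}"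

definition fun_scale :: "'a::comm_ring_1 \<Rightarrow> ('b \<Rightarrow> 'a) \<Rightarrow> 'b \<Rightarrow> 'a" where
  "fun_scale c f = (\<lambda>x. c * f x)"

text \<open>Linear forms on \<open>M\<^sup>*\<close> are represented by functions that vanish outside \<open>M\<^sup>*\<close>.\<close>

definition bidual :: "('a::comm_ring_1 \<Rightarrow> 'm::ab_group_add \<Rightarrow> 'm) \<Rightarrow> (('m \<Rightarrow> 'a) \<Rightarrow> 'a) set" where
  "bidual scale =
     {\<Phi>. (\<forall>f\<in>dual scale. \<forall>g\<in>dual scale. \<Phi> (f + g) = \<Phi> f + \<Phi> g) \<and>
         (\<forall>c. \<forall>f\<in>dual scale. \<Phi> (fun_scale c f) = c * \<Phi> f) \<and>
         (\<forall>f. f \<notin> dual scale \<longrightarrow> \<Phi> f = 0)}"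

definition to_bidual ::
  "('a::comm_ring_1 \<Rightarrow> 'm::ab_group_add \<Rightarrow> 'm) \<Rightarrow> 'm \<Rightarrow> ('m \<Rightarrow> 'a) \<Rightarrow> 'a" where
  "to_bidual scale x = (\<lambda>f. if f \<in> dual scale then f x else 0)"

definition bidual_coordinates ::
  "('a::comm_ring_1 \<Rightarrow> 'm::ab_group_add \<Rightarrow> 'm) \<Rightarrow> nat \<Rightarrow> ((('m \<Rightarrow> 'a) \<Rightarrow> 'a) \<Rightarrow> 'a vec) \<Rightarrow> bool" where
  "bidual_coordinates scale r \<phi> \<longleftrightarrow>
     linear_iso fun_scale (bidual scale) (\<cdot>\<^sub>v) (carrier_vec r) \<phi>"

text \<open>\<open>M\<close> as a submodule of \<open>R\<^sup>r = M\<^sup>*\<^sup>*\<close>.\<close>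

definition embedded_module ::
  "('a::comm_ring_1 \<Rightarrow> 'm::ab_group_add \<Rightarrow> 'm) \<Rightarrow> ((('m \<Rightarrow> 'a) \<Rightarrow> 'a) \<Rightarrow> 'a vec) \<Rightarrow> 'a vec set" where
  "embedded_module scale \<phi> = range (\<lambda>x. \<phi> (to_bidual scale x))"

definition column_module :: "'a::comm_ring_1 mat \<Rightarrow> 'a vec set" where
  "column_module A = {A *\<^sub>v c |c. c \<in> carrier_vec (dim_col A)}"

definition minors_ideal :: "'a::comm_ring_1 mat \<Rightarrow> 'a set" where
  "minors_ideal A =
     ideal_gen {det (submatrix A UNIV J) |J. J \<subseteq> {..<dim_col A} \<and> card J = dim_row A}"

text \<open>\<open>I = I(M)\<close>, computed from some identification of \<open>M\<^sup>*\<^sup>*\<close> with \<open>R\<^sup>r\<close> and some matrix whose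
  columns generate \<open>M\<close>; neither choice affects the ideal.\<close>

definition is_ideal_of_minors ::
  "('a::comm_ring_1 \<Rightarrow> 'm::ab_group_add \<Rightarrow> 'm) \<Rightarrow> nat \<Rightarrow> 'a set \<Rightarrow> bool" where
  "is_ideal_of_minors scale r I \<longleftrightarrow>
     (\<exists>\<phi> A. bidual_coordinates scale r \<phi> \<and> dim_row A = r \<and>
        column_module A = embedded_module scale \<phi> \<and> I = minors_ideal A)"

section \<open>Integral closure of a module\<close>

definition discrete_valuation :: "('k::field \<Rightarrow> int) \<Rightarrow> bool" where
  "discrete_valuation v \<longleftrightarrow>
     (\<forall>x y. x \<noteq> 0 \<and> y \<noteq> 0 \<longrightarrow> v (x * y) = v x + v y) \<and>
     (\<forall>x y. x \<noteq> 0 \<and> y \<noteq> 0 \<and> x + y \<noteq> 0 \<longrightarrow> min (v x) (v y) \<le> v (x + y)) \<and>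
     v ` (UNIV - {0}) = UNIV"

text \<open>The value \<open>v 0\<close> is irrelevant. A discrete valuation ring between \<open>R\<close> and its fraction field
  has that same fraction field, so its valuation is defined on all of \<open>'a fract\<close>.\<close>

definition dvr_between :: "'a::idom fract set \<Rightarrow> bool" where
  "dvr_between V \<longleftrightarrow>
     range to_fract \<subseteq> V \<and> (\<exists>v. discrete_valuation v \<and> V = {x. x = 0 \<or> 0 \<le> v x})"

text \<open>\<open>x \<in> MV\<close> for \<open>M \<subseteq> R\<^sup>r\<close>, where \<open>R\<^sup>r \<otimes> K = K\<^sup>r\<close>.\<close>

definition in_ring_span :: "nat \<Rightarrow> 'a::idom vec set \<Rightarrow> 'a fract set \<Rightarrow> 'a vec \<Rightarrow> bool" where
  "in_ring_span r M V x \<longleftrightarrow>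
     (\<exists>n c w. (\<forall>j<n. c j \<in> V \<and> w j \<in> M) \<and>
        (\<forall>i<r. to_fract (x $ i) = (\<Sum>j<n::nat. c j * to_fract (w j $ i))))"

definition integral_over_module :: "nat \<Rightarrow> 'a::idom vec set \<Rightarrow> 'a vec \<Rightarrow> bool" where
  "integral_over_module r M x \<longleftrightarrow> (\<forall>V. dvr_between V \<longrightarrow> in_ring_span r M V x)"

text \<open>The condition is invariant under change of basis of \<open>M\<^sup>*\<^sup>*\<close>, so one identification with
  \<open>R\<^sup>r\<close> suffices.\<close>

definition integrally_closed_module ::
  "('a::idom \<Rightarrow> 'm::ab_group_add \<Rightarrow> 'm) \<Rightarrow> nat \<Rightarrow> bool" where
  "integrally_closed_module scale r \<longleftrightarrow>
     (\<exists>\<phi>. bidual_coordinates scale r \<phi> \<and>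
        (\<forall>x\<in>carrier_vec r. integral_over_module r (embedded_module scale \<phi>) x \<longrightarrow>
           x \<in> embedded_module scale \<phi>))"

end

theory Submission
  imports Defs
begin

text \<open>Write \<open>F = R\<^sup>r\<close> for the double dual of \<open>M\<close>. As \<open>M\<close> has no free summand, \<open>M \<subseteq> \<mm>F\<close>:
  a coordinate of \<open>F\<close> with a unit value on \<open>M\<close> would split off a copy of \<open>R\<close>
  (\<open>linear_form_in_maximal_ideal\<close>). If conversely \<open>e \<in> F - \<mm>F\<close> satisfies \<open>\<mm>e \<subseteq> M\<close>, then a linear form
  \<open>f\<close> on \<open>F\<close> with \<open>f e = 1\<close> maps \<open>M\<close> onto \<open>\<mm>\<close>, and \<open>a \<mapsto> a e\<close> is a section
  (\<open>direct_summand_of_section\<close>). So it is enough to find such an \<open>e\<close>.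

  Since \<open>I\<close> has order \<open>r\<close>, some \<open>r \<times> r\<close> minor of \<open>M\<close> lies outside \<open>\<mm>\<^sup>r\<^sup>+\<^sup>1\<close>. It
  is the value at two generators of \<open>\<mm>\<close> of a binary form of degree \<open>r\<close> that is nonzero over the
  residue field, and as that field is infinite, the form does not vanish everywhere. A change of generators then gives
  \<open>\<mm> = (x, y)\<close> such that \<open>M\<close> contains the columns of a matrix \<open>W = y + x U\<close>; in particular
  \<open>M + xF = \<mm>F\<close> (\<open>transversal_parameter\<close>).

  Every \<open>w \<in> M\<close> is therefore \<open>W q + x v\<close> for some \<open>q, v \<in> F\<close>, and then \<open>x v \<in> M\<close>. If all these \<open>v\<close>
  were in \<open>\<mm>F\<close>, then every maximal minor of \<open>M\<close> would be a multiple of \<open>det W\<close> modulo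
  \<open>\<mm>\<^sup>r\<^sup>+\<^sup>1\<close>, and the image of \<open>I\<close> would be at most one-dimensional. Hence \<open>x e \<in> M\<close> for some
  \<open>e \<in> F - \<mm>F\<close> (\<open>exists_colon_element\<close>).

  It remains to see \<open>y e \<in> M\<close>, and here \<open>M\<close> being integrally closed enters
  (\<open>in_ring_span_colon_element\<close>). Let \<open>V\<close> be a discrete valuation ring between \<open>R\<close> and its fraction
  field. If \<open>v x \<le> v y\<close>, then \<open>y e\<close> is a \<open>V\<close>-multiple of \<open>x e\<close>. If \<open>v x > v y\<close>, then \<open>W / y\<close>
  is the identity matrix modulo the maximal ideal of \<open>V\<close>, so it is invertible over \<open>V\<close> and
  \<open>y F \<subseteq> W V\<^sup>r \<subseteq> M V\<close>.\<close>

section \<open>Ideals and local rings\<close>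

interpretation ideal: Modules.module "(*) :: 'a::comm_ring_1 \<Rightarrow> 'a \<Rightarrow> 'a"
  by (rule module_mult)

(* Read as a rewrite rule, this instance regroups products to the left and so makes the
   simplifier loop together with associativity. *)
declare ideal.scale_scale [simp del]

lemma ideal_mult_right: "is_ideal J \<Longrightarrow> a \<in> J \<Longrightarrow> a * c \<in> J"
  by (metis ideal.subspace_scale mult.commute)

lemma ideal_eq_UNIV: "is_ideal J \<Longrightarrow> 1 \<in> J \<Longrightarrow> J = UNIV"
  using ideal_mult_right[of J 1] by auto

lemma is_ideal_Union_chain:
  assumes "\<C> \<noteq> {}" "\<And>J. J \<in> \<C> \<Longrightarrow> is_ideal J" "\<And>J K. J \<in> \<C> \<Longrightarrow> K \<in> \<C> \<Longrightarrow> J \<subseteq> K \<or> K \<subseteq> J"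
  shows "is_ideal (\<Union>\<C>)"
proof (rule ideal.subspaceI)
  show "0 \<in> \<Union>\<C>"
    using assms(1,2) ideal.subspace_0 by fast
  show "a + b \<in> \<Union>\<C>" if ab: "a \<in> \<Union>\<C>" "b \<in> \<Union>\<C>" for a b
  proof -
    obtain J K where JK: "J \<in> \<C>" "a \<in> J" "K \<in> \<C>" "b \<in> K"
      using ab by blast
    then consider "J \<subseteq> K" | "K \<subseteq> J"
      using assms(3) by blast
    then show ?thesis
      by cases (use JK assms(2) ideal.subspace_add in blast)+
  qed
  show "c * a \<in> \<Union>\<C>" if "a \<in> \<Union>\<C>" for c a
    using that assms(2) ideal.subspace_scale by fast
qed

text \<open>A proper ideal lies in a maximal one, by Zorn's lemma; so in a local ring a nonunit lies in
  the maximal ideal.\<close>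

lemma local_ring_unit:
  assumes loc: "local_ring \<mm>" and a: "a \<notin> \<mm>"
  shows "\<exists>b. a * b = 1"
proof (rule ccontr)
  assume nonunit: "\<nexists>b. a * b = 1"
  define \<S> where "\<S> = {J. is_ideal J \<and> a \<in> J \<and> 1 \<notin> J}"
  have "range (\<lambda>c. c * a) \<in> \<S>"
  proof -
    have "is_ideal (range (\<lambda>c. c * a))"
    proof (rule ideal.subspaceI)
      show "0 \<in> range (\<lambda>c. c * a)"
        by (metis mult_zero_left rangeI)
    next
      fix u v assume "u \<in> range (\<lambda>c. c * a)" "v \<in> range (\<lambda>c. c * a)"
      then show "u + v \<in> range (\<lambda>c. c * a)"
        by (auto simp flip: distrib_right)
    next
      fix c u assume "u \<in> range (\<lambda>c. c * a)"
      then show "c * u \<in> range (\<lambda>c. c * a)"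
        by (auto simp flip: mult.assoc)
    qed
    moreover have "a \<in> range (\<lambda>c. c * a)"
      by (metis mult_1 rangeI)
    moreover have "1 \<notin> range (\<lambda>c. c * a)"
      using nonunit by (metis imageE mult.commute)
    ultimately show ?thesis
      by (simp add: \<S>_def)
  qed
  then have "\<S> \<noteq> {}"
    by blast
  moreover have "\<Union>\<C> \<in> \<S>" if "\<C> \<noteq> {}" "subset.chain \<S> \<C>" for \<C>
  proof -
    have sub: "\<And>J. J \<in> \<C> \<Longrightarrow> J \<in> \<S>"
      and chain: "\<And>J K. J \<in> \<C> \<Longrightarrow> K \<in> \<C> \<Longrightarrow> J \<subseteq> K \<or> K \<subseteq> J"
      using that(2) by (auto simp: subset_chain_def)
    have "is_ideal (\<Union>\<C>)"
      using is_ideal_Union_chain[OF that(1) _ chain] sub by (auto simp: \<S>_def)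
    then show ?thesis
      using sub that(1) by (auto simp: \<S>_def)
  qed
  ultimately obtain P where P: "P \<in> \<S>" and max: "\<And>J. J \<in> \<S> \<Longrightarrow> P \<subseteq> J \<Longrightarrow> J = P"
    using subset_Zorn_nonempty[of \<S>] by blast
  have "is_maximal_ideal P"
    unfolding is_maximal_ideal_def
  proof (intro conjI allI impI)
    show "is_ideal P" "P \<noteq> UNIV"
      using P by (auto simp: \<S>_def)
    show "J = P \<or> J = UNIV" if "is_ideal J \<and> P \<subseteq> J" for J
      using that max[of J] P ideal_eq_UNIV[of J] by (auto simp: \<S>_def)
  qed
  then have "P = \<mm>"
    using loc by (simp add: local_ring_def)
  then show False
    using P a by (simp add: \<S>_def)
qed

lemma local_ring_maximal:
  assumes "local_ring \<mm>"
  shows "is_ideal \<mm>" "1 \<notin> \<mm>"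
  using assms ideal_eq_UNIV by (auto simp: local_ring_def is_maximal_ideal_def)

lemma local_ring_cancel:
  assumes "local_ring \<mm>" "a * b \<in> \<mm>" "a \<notin> \<mm>"
  shows "b \<in> \<mm>"
proof -
  obtain c where "a * c = 1"
    using local_ring_unit assms(1,3) by blast
  then have "b = c * (a * b)"
    by (metis mult.assoc mult.commute mult_1)
  then show ?thesis
    using assms(1,2) ideal.subspace_scale local_ring_maximal(1) by metis
qed

lemma ideal_gen_pair: "ideal_gen {x, y} = {p * x + q * y |p q. True}"
proof -
  have "a \<in> ideal_gen {x, y} \<longleftrightarrow> (\<exists>p q. a = p * x + q * y)" for a
    by (auto simp: ideal.span_insert ideal.span_empty algebra_simps eq_diff_eq)
  then show ?thesis
    by auto
qed

text \<open>Over the residue field this says that a nonzero polynomial has no more roots than its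
  degree. The usual proof works over \<open>R\<close>: after splitting off a linear factor at \<open>t\<close>, the quotient
  has values in \<open>\<mm>\<close> at the other points \<open>s\<close>, since \<open>s - t\<close> is not in the prime ideal \<open>\<mm>\<close>.\<close>

lemma coeffs_in_maximal_ideal:
  assumes loc: "local_ring \<mm>"
    and "finite T" "\<And>s t. s \<in> T \<Longrightarrow> t \<in> T \<Longrightarrow> s \<noteq> t \<Longrightarrow> s - t \<notin> \<mm>"
    and "degree p < card T" "\<And>t. t \<in> T \<Longrightarrow> poly p t \<in> \<mm>"
  shows "coeff p k \<in> \<mm>"
  using assms(2-)
proof (induction "card T" arbitrary: T p k)
  case 0
  then show ?case by simp
next
  case (Suc n)
  have idm: "is_ideal \<mm>"
    using local_ring_maximal loc by blast
  obtain t where t: "t \<in> T"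
    using Suc.hyps(2) by fastforce
  define q where "q = synthetic_div p t"
  have p: "p = [:- t, 1:] * q + [:poly p t:]"
    unfolding q_def by (rule synthetic_div_correct'[symmetric])
  have q: "coeff q j \<in> \<mm>" for j
  proof (cases "degree p = 0")
    case True
    then have "q = 0"
      by (simp add: q_def synthetic_div_eq_0_iff)
    then show ?thesis
      using idm ideal.subspace_0 by simp
  next
    case False
    have "poly q s \<in> \<mm>" if s: "s \<in> T - {t}" for s
    proof (rule local_ring_cancel[OF loc])
      have "(s - t) * poly q s = poly p s - poly p t"
        by (subst p) (simp add: algebra_simps)
      then show "(s - t) * poly q s \<in> \<mm>"
        using ideal.subspace_diff[OF idm, of "poly p s" "poly p t"] Suc.prems(4) s t by simp
      show "s - t \<notin> \<mm>"
        using Suc.prems(2) s t by auto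
    qed
    then show ?thesis
      using Suc.hyps(1)[of "T - {t}" q] Suc.hyps(2) Suc.prems(1-3) t False
      by (simp add: q_def degree_synthetic_div)
  qed
  have "coeff p k = (case k of 0 \<Rightarrow> poly p t | Suc j \<Rightarrow> coeff q j) - t * coeff q k"
    by (subst p) (simp split: nat.split)
  then show ?case
    using q Suc.prems(4)[OF t] ideal.subspace_diff[OF idm] ideal.subspace_scale[OF idm]
    by (simp split: nat.split)
qed

lemma exists_incongruent_elements:
  assumes "infinite (residue_ring \<mm>)" "is_ideal \<mm>"
  shows "\<exists>T. finite T \<and> card T = n \<and> (\<forall>s\<in>T. \<forall>t\<in>T. s \<noteq> t \<longrightarrow> s - t \<notin> \<mm>)"
proof -
  obtain Q where Q: "finite Q" "card Q = n" "Q \<subseteq> residue_ring \<mm>"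
    using infinite_arbitrarily_large[OF assms(1)] by blast
  define rep where "rep = (\<lambda>A. SOME s. A = {t. s - t \<in> \<mm>})"
  have rep: "A = {t. rep A - t \<in> \<mm>}" if "A \<in> Q" for A
  proof -
    have "\<exists>s. A = {t. s - t \<in> \<mm>}"
      using that Q(3) by (auto simp: residue_ring_def quotient_def)
    then show ?thesis
      unfolding rep_def by (rule someI_ex)
  qed
  then have inj: "inj_on rep Q"
    by (metis inj_onI)
  have "rep A - rep B \<notin> \<mm>" if "A \<in> Q" "B \<in> Q" "A \<noteq> B" for A B
  proof
    assume *: "rep A - rep B \<in> \<mm>"
    have "rep A - t \<in> \<mm> \<longleftrightarrow> rep B - t \<in> \<mm>" for t
      using ideal.subspace_diff[OF assms(2) _ *, of "rep A - t"]
        ideal.subspace_add[OF assms(2) *, of "rep B - t"] by (auto simp: algebra_simps)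
    then show False
      using rep that by blast
  qed
  then show ?thesis
    using Q inj by (intro exI[of _ "rep ` Q"]) (auto simp: card_image)
qed

section \<open>Powers of an ideal, determinants and pencils of matrices\<close>

lemma is_ideal_power: "is_ideal (ideal_power J n)"
  by (cases n) (auto simp: ideal.subspace_span)

lemma mult_in_ideal_power: "a \<in> J \<Longrightarrow> b \<in> ideal_power J n \<Longrightarrow> a * b \<in> ideal_power J (Suc n)"
  by (auto intro: ideal.span_base)

lemma power_mult_in_ideal_power:
  assumes "a \<in> J" "b \<in> ideal_power J n"
  shows "a ^ i * b \<in> ideal_power J (i + n)"
proof (induction i)
  case (Suc i)
  then show ?case
    using mult_in_ideal_power[OF assms(1)] by (simp add: mult.assoc)
qed (use assms in simp)

lemma prod_in_ideal_power:
  assumes "finite S" "\<And>i. i \<in> S \<Longrightarrow> a i \<in> J"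
  shows "prod a S \<in> ideal_power J (card S)"
  using assms
proof (induction S rule: finite_induct)
  case (insert i S)
  then show ?case
    using mult_in_ideal_power[of "a i"] by simp
qed simp

text \<open>A product of \<open>n\<close> elements of \<open>J\<close> changes by an element of \<open>J\<^sup>n\<^sup>+\<^sup>1\<close> when its factors change
  by elements of \<open>J\<^sup>2\<close>; by the Leibniz formula so does an \<open>n \<times> n\<close> determinant. Only changes by
  multiples of a fixed \<open>s \<in> J\<close> occur below.\<close>

lemma prod_perturbation_in_ideal_power:
  assumes "is_ideal J" "finite S" "s \<in> J" "\<And>i. i \<in> S \<Longrightarrow> a i \<in> J" "\<And>i. i \<in> S \<Longrightarrow> b i \<in> J"
  shows "(\<Prod>i\<in>S. a i + s * b i) - prod a S \<in> ideal_power J (Suc (card S))"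
  using assms(2,4,5)
proof (induction S rule: finite_induct)
  case empty
  then show ?case
    using ideal.subspace_0[OF is_ideal_power[of J "Suc 0"]] by (simp del: ideal_power.simps)
next
  case (insert i S)
  define P where "P = (\<Prod>i\<in>S. a i + s * b i)"
  have "P \<in> ideal_power J (card S)"
    unfolding P_def using insert ideal.subspace_add[OF assms(1)]
      ideal_mult_right[OF assms(1,3)]
    by (intro prod_in_ideal_power) (auto simp del: ideal_power.simps)
  then have "s * (b i * P) \<in> ideal_power J (Suc (Suc (card S)))"
    by (intro mult_in_ideal_power assms(3) insert.prems insertI1)
  moreover have "a i * (P - prod a S) \<in> ideal_power J (Suc (Suc (card S)))"
    unfolding P_def by (intro mult_in_ideal_power insert.IH insert.prems insertI1 insertI2)
  ultimately have "s * (b i * P) + a i * (P - prod a S) \<in> ideal_power J (Suc (Suc (card S)))"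
    by (rule ideal.subspace_add[OF is_ideal_power])
  moreover have "s * (b i * P) + a i * (P - prod a S) = (a i + s * b i) * P - a i * prod a S"
    by (simp add: algebra_simps)
  ultimately show ?case
    unfolding prod.insert[OF insert.hyps] card_insert_disjoint[OF insert.hyps] P_def by metis
qed

lemma det_in_ideal_power:
  assumes "A \<in> carrier_mat n n" "\<And>i j. i < n \<Longrightarrow> j < n \<Longrightarrow> A $$ (i, j) \<in> J"
  shows "det A \<in> ideal_power J n"
  unfolding det_def'[OF assms(1)]
proof (intro ideal.subspace_sum[OF is_ideal_power] ideal.subspace_scale[OF is_ideal_power])
  fix p assume "p \<in> {p. p permutes {0..<n}}"
  then have "p i < n" if "i < n" for i
    using that permutes_in_image[of p "{0..<n}" i] by auto
  then show "(\<Prod>i = 0..<n. A $$ (i, p i)) \<in> ideal_power J n"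
    using prod_in_ideal_power[of "{0..<n}" "\<lambda>i. A $$ (i, p i)" J] assms(2) by simp
qed

lemma det_perturbation_in_ideal_power:
  assumes "is_ideal J" "A \<in> carrier_mat n n" "B \<in> carrier_mat n n" "s \<in> J"
    and "\<And>i j. i < n \<Longrightarrow> j < n \<Longrightarrow> A $$ (i, j) \<in> J"
    and "\<And>i j. i < n \<Longrightarrow> j < n \<Longrightarrow> B $$ (i, j) \<in> J"
  shows "det (A + s \<cdot>\<^sub>m B) - det A \<in> ideal_power J (Suc n)"
proof -
  have AB: "A + s \<cdot>\<^sub>m B \<in> carrier_mat n n"
    using assms by auto
  have "(\<Sum>p | p permutes {0..<n}. signof p *
          ((\<Prod>i = 0..<n. A $$ (i, p i) + s * B $$ (i, p i)) - (\<Prod>i = 0..<n. A $$ (i, p i))))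
        \<in> ideal_power J (Suc n)"
  proof (intro ideal.subspace_sum[OF is_ideal_power] ideal.subspace_scale[OF is_ideal_power])
    fix p assume "p \<in> {p. p permutes {0..<n}}"
    then have "p i < n" if "i < n" for i
      using that permutes_in_image[of p "{0..<n}" i] by auto
    then show "(\<Prod>i = 0..<n. A $$ (i, p i) + s * B $$ (i, p i)) - (\<Prod>i = 0..<n. A $$ (i, p i))
        \<in> ideal_power J (Suc n)"
      using prod_perturbation_in_ideal_power[of J "{0..<n}" s "\<lambda>i. A $$ (i, p i)"
          "\<lambda>i. B $$ (i, p i)"] assms by simp
  qed
  moreover have "(\<Prod>i = 0..<n. (A + s \<cdot>\<^sub>m B) $$ (i, p i)) =
      (\<Prod>i = 0..<n. A $$ (i, p i) + s * B $$ (i, p i))" if "p permutes {0..<n}" for p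
    using that permutes_in_image[of p "{0..<n}"] assms(2,3) by (intro prod.cong) auto
  ultimately show ?thesis
    unfolding det_def'[OF AB] det_def'[OF assms(2)]
    by (simp add: sum_subtractf algebra_simps del: ideal_power.simps)
qed

text \<open>\<open>pencil_poly C D\<close> is \<open>det (C + D T)\<close> as a polynomial in \<open>T\<close>; its coefficients
  are those of the binary form \<open>det (y C + x D)\<close>.\<close>

definition pencil_poly :: "'a::comm_ring_1 mat \<Rightarrow> 'a mat \<Rightarrow> 'a poly" where
  "pencil_poly C D = det (mat (dim_row C) (dim_row C) (\<lambda>ij. [:C $$ ij, D $$ ij:]))"

lemma prod_linear_forms:
  assumes "finite S"
  shows "degree (\<Prod>i\<in>S. [:a i, b i:]) \<le> card S"
    and "(\<Prod>i\<in>S. y * a i + x * b i) =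
      (\<Sum>k\<le>card S. coeff (\<Prod>i\<in>S. [:a i, b i:]) k * y ^ (card S - k) * x ^ k)"
proof -
  show deg: "degree (\<Prod>i\<in>S. [:a i, b i:]) \<le> card S" for S
  proof -
    have "degree (\<Prod>i\<in>S. [:a i, b i:]) \<le> (\<Sum>i\<in>S. degree [:a i, b i:])"
      using degree_prod_sum_le[of S "\<lambda>i. [:a i, b i:]"] by (cases "finite S") (auto simp: o_def)
    also have "\<dots> \<le> (\<Sum>i\<in>S. 1)"
      by (rule sum_mono) simp
    finally show ?thesis by simp
  qed
  show "(\<Prod>i\<in>S. y * a i + x * b i) =
      (\<Sum>k\<le>card S. coeff (\<Prod>i\<in>S. [:a i, b i:]) k * y ^ (card S - k) * x ^ k)"
    using assms
  proof (induction S rule: finite_induct)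
    case (insert i S)
    define p n where "p = (\<Prod>i\<in>S. [:a i, b i:])" and "n = card S"
    (* As p has degree at most n, the sum for y times the form may run up to n + 1. *)
    have "coeff p (Suc n) = 0"
      using deg[of S] by (auto simp: p_def n_def intro: coeff_eq_0)
    then have *: "y * (\<Sum>k\<le>n. coeff p k * y ^ (n - k) * x ^ k) =
        (\<Sum>k\<le>Suc n. coeff p k * y ^ (Suc n - k) * x ^ k)"
      by (simp add: sum_distrib_left Suc_diff_le algebra_simps)
    have **: "(\<Sum>k\<le>Suc n. coeff (pCons 0 p) k * y ^ (Suc n - k) * x ^ k) =
        x * (\<Sum>k\<le>n. coeff p k * y ^ (n - k) * x ^ k)"
      by (subst sum.atMost_Suc_shift) (simp add: sum_distrib_left algebra_simps)
    have "(\<Prod>i\<in>insert i S. y * a i + x * b i) =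
        (y * a i + x * b i) * (\<Sum>k\<le>n. coeff p k * y ^ (n - k) * x ^ k)"
      using insert by (simp add: p_def n_def)
    also have "\<dots> = a i * (y * (\<Sum>k\<le>n. coeff p k * y ^ (n - k) * x ^ k)) +
        b i * (x * (\<Sum>k\<le>n. coeff p k * y ^ (n - k) * x ^ k))"
      by (simp add: algebra_simps)
    also have "\<dots> = (\<Sum>k\<le>Suc n. (a i * coeff p k + b i * coeff (pCons 0 p) k) *
        y ^ (Suc n - k) * x ^ k)"
      unfolding * **[symmetric] by (simp only: sum_distrib_left sum.distrib algebra_simps)
    also have "\<dots> = (\<Sum>k\<le>Suc n. coeff ([:a i, b i:] * p) k * y ^ (Suc n - k) * x ^ k)"
      by (intro sum.cong refl) (simp add: algebra_simps coeff_pCons split: nat.split)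
    finally show ?case
      using insert by (simp add: p_def n_def del: mult_pCons_left)
  qed simp
qed

lemma pencil_poly_altdef:
  assumes "C \<in> carrier_mat n n"
  shows "pencil_poly C D = (\<Sum>p | p permutes {0..<n}. signof p *
    (\<Prod>i = 0..<n. [:C $$ (i, p i), D $$ (i, p i):]))"
proof -
  have "pencil_poly C D = det (mat n n (\<lambda>ij. [:C $$ ij, D $$ ij:]))"
    using assms by (simp add: pencil_poly_def)
  also have "\<dots> = (\<Sum>p | p permutes {0..<n}. signof p *
    (\<Prod>i = 0..<n. mat n n (\<lambda>ij. [:C $$ ij, D $$ ij:]) $$ (i, p i)))"
    by (rule det_def') simp
  also have "\<dots> = (\<Sum>p | p permutes {0..<n}. signof p *
    (\<Prod>i = 0..<n. [:C $$ (i, p i), D $$ (i, p i):]))"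
    using permutes_in_image[of _ "{0..<n}"]
    by (intro sum.cong refl arg_cong2[of _ _ _ _ "(*)"] prod.cong) auto
  finally show ?thesis .
qed

lemma degree_pencil_poly:
  assumes "C \<in> carrier_mat n n"
  shows "degree (pencil_poly C D) \<le> n"
  unfolding pencil_poly_altdef[OF assms]
proof (intro degree_sum_le)
  fix p assume "p \<in> {p. p permutes {0..<n}}"
  have "degree (signof p :: 'a poly) = 0"
    by (simp add: sign_def)
  then show "degree (signof p * (\<Prod>i = 0..<n. [:C $$ (i, p i), D $$ (i, p i):])) \<le> n"
    using degree_mult_le[of "signof p" "\<Prod>i = 0..<n. [:C $$ (i, p i), D $$ (i, p i):]"]
      prod_linear_forms(1)[of "{0..<n}" "\<lambda>i. C $$ (i, p i)" "\<lambda>i. D $$ (i, p i)"] by simp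
qed (simp add: finite_permutations)

lemma det_pencil:
  assumes C: "C \<in> carrier_mat n n" and D: "D \<in> carrier_mat n n"
  shows "det (y \<cdot>\<^sub>m C + x \<cdot>\<^sub>m D) = (\<Sum>k\<le>n. coeff (pencil_poly C D) k * y ^ (n - k) * x ^ k)"
proof -
  define P where "P = (\<lambda>p. \<Prod>i = 0..<n. [:C $$ (i, p i), D $$ (i, p i):])"
  have carr: "y \<cdot>\<^sub>m C + x \<cdot>\<^sub>m D \<in> carrier_mat n n"
    using C D by auto
  have "det (y \<cdot>\<^sub>m C + x \<cdot>\<^sub>m D) = (\<Sum>p | p permutes {0..<n}. signof p *
      (\<Prod>i = 0..<n. y * C $$ (i, p i) + x * D $$ (i, p i)))"
    unfolding det_def'[OF carr] using permutes_in_image[of _ "{0..<n}"] C D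
    by (intro sum.cong refl arg_cong2[of _ _ _ _ "(*)"] prod.cong) auto
  also have "\<dots> = (\<Sum>p | p permutes {0..<n}. signof p *
      (\<Sum>k\<le>n. coeff (P p) k * y ^ (n - k) * x ^ k))"
    unfolding P_def
    by (subst prod_linear_forms(2)) (simp_all only: card_atLeastLessThan finite_atLeastLessThan diff_zero)
  also have "\<dots> = (\<Sum>k\<le>n. (\<Sum>p | p permutes {0..<n}. signof p * coeff (P p) k) * y ^ (n - k) * x ^ k)"
    unfolding sum_distrib_left sum_distrib_right by (subst sum.swap) (simp only: mult.assoc)
  also have "\<dots> = (\<Sum>k\<le>n. coeff (pencil_poly C D) k * y ^ (n - k) * x ^ k)"
  proof -
    have "signof p * coeff (P p) k = coeff (signof p * P p) k" for p k
      by (simp add: sign_def)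
    then show ?thesis
      by (simp add: pencil_poly_altdef[OF C] coeff_sum P_def)
  qed
  finally show ?thesis .
qed

lemma poly_pencil_poly:
  assumes "C \<in> carrier_mat n n" "D \<in> carrier_mat n n"
  shows "poly (pencil_poly C D) t = det (C + t \<cdot>\<^sub>m D)"
proof -
  have "poly (pencil_poly C D) t = (\<Sum>k\<le>n. coeff (pencil_poly C D) k * t ^ k)"
    using poly_as_sum_of_monoms'[OF degree_pencil_poly[OF assms(1), of D]]
    by (metis (no_types, lifting) poly_monom poly_sum sum.cong)
  also have "\<dots> = det (1 \<cdot>\<^sub>m C + t \<cdot>\<^sub>m D)"
    by (simp add: det_pencil[OF assms])
  also have "1 \<cdot>\<^sub>m C = C"
    by (rule eq_matI) auto
  finally show ?thesis .
qed

section \<open>Modules generated by the columns of a matrix\<close>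

lemma smult_mat_mult_vec:
  assumes "A \<in> carrier_mat m n" "c \<in> carrier_vec n"
  shows "(a \<cdot>\<^sub>m A) *\<^sub>v c = a \<cdot>\<^sub>v (A *\<^sub>v c)"
  using assms by (intro eq_vecI) (auto simp: scalar_prod_def sum_distrib_left mult.assoc)

lemma column_module_diff:
  assumes "u \<in> column_module A" "w \<in> column_module A"
  shows "u - w \<in> column_module A"
proof -
  obtain c c' where "u = A *\<^sub>v c" "c \<in> carrier_vec (dim_col A)"
    "w = A *\<^sub>v c'" "c' \<in> carrier_vec (dim_col A)"
    using assms by (auto simp: column_module_def)
  then show ?thesis
    unfolding column_module_def
    by (auto simp: mult_minus_distrib_mat_vec[of A "dim_row A" "dim_col A"]
        intro!: exI[of _ "c - c'"])
qed

lemma mult_mat_vec_in_column_module: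
  assumes "A \<in> carrier_mat r n" "B \<in> carrier_mat r k" "\<And>j. j < k \<Longrightarrow> col B j \<in> column_module A"
    and "c \<in> carrier_vec k"
  shows "B *\<^sub>v c \<in> column_module A"
proof -
  have "\<forall>j. \<exists>q. j < k \<longrightarrow> q \<in> carrier_vec n \<and> col B j = A *\<^sub>v q"
    using assms(1,3) by (auto simp: column_module_def)
  then obtain q where q: "\<And>j. j < k \<Longrightarrow> q j \<in> carrier_vec n" "\<And>j. j < k \<Longrightarrow> col B j = A *\<^sub>v q j"
    by metis
  define Q where "Q = mat n k (\<lambda>(i, j). q j $ i)"
  have Q: "Q \<in> carrier_mat n k"
    by (simp add: Q_def)
  have "col (A * Q) j = col B j" if "j < k" for j
  proof -
    have "col Q j = q j"
      using that q(1)[OF that] by (intro eq_vecI) (auto simp: Q_def)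
    then show ?thesis
      using col_mult2[OF assms(1) Q that] q(2)[OF that] by simp
  qed
  then have "B = A * Q"
    using assms(1,2) Q by (intro mat_col_eqI) auto
  then have "B *\<^sub>v c = A *\<^sub>v (Q *\<^sub>v c)"
    using assoc_mult_mat_vec[OF assms(1) Q assms(4)] by simp
  then show ?thesis
    using assms(1,4) Q by (auto simp: column_module_def)
qed

lemma column_module_entries:
  assumes "is_ideal J" "A \<in> carrier_mat r n" "\<And>i j. i < r \<Longrightarrow> j < n \<Longrightarrow> A $$ (i, j) \<in> J"
    and "w \<in> column_module A" "i < r"
  shows "w $ i \<in> J"
proof -
  obtain c where "c \<in> carrier_vec n" "w = A *\<^sub>v c"
    using assms(2,4) by (auto simp: column_module_def)
  then have "w $ i = (\<Sum>j = 0..<n. A $$ (i, j) * c $ j)"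
    using assms(2,5) by (auto simp: scalar_prod_def intro!: sum.cong)
  then show ?thesis
    using assms by (auto intro!: ideal.subspace_sum ideal_mult_right)
qed

lemma col_in_column_module:
  assumes "j < dim_col A"
  shows "col A j \<in> column_module A"
proof -
  have "col A j = A *\<^sub>v unit_vec (dim_col A) j"
    using assms by (intro eq_vecI) (simp_all add: row_def)
  then show ?thesis
    by (auto simp: column_module_def)
qed

lemma maximal_minor_columns:
  assumes "J \<subseteq> {..<dim_col A}" "card J = dim_row A"
  shows "submatrix A UNIV J \<in> carrier_mat (dim_row A) (dim_row A)"
    and "j < dim_row A \<Longrightarrow> col (submatrix A UNIV J) j \<in> column_module A"
proof -
  have "{j. j < dim_col A \<and> j \<in> J} = J"
    using assms(1) by auto
  then have cardJ: "card {j. j < dim_col A \<and> j \<in> J} = dim_row A"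
    using assms(2) by simp
  show B: "submatrix A UNIV J \<in> carrier_mat (dim_row A) (dim_row A)"
    using cardJ by (intro carrier_matI) (auto simp: dim_submatrix)
  show "col (submatrix A UNIV J) j \<in> column_module A" if "j < dim_row A"
  proof -
    have pick: "pick J j < dim_col A"
      using that cardJ by (simp add: pick_le)
    have "col (submatrix A UNIV J) j = col A (pick J j)"
      using that B cardJ pick by (intro eq_vecI) (auto simp: submatrix_def pick_UNIV)
    then show ?thesis
      using col_in_column_module[OF pick] by simp
  qed
qed

section \<open>A general parameter\<close>

text \<open>Write \<open>B = a C + b D\<close>. If \<open>det (C + t D)\<close> were in \<open>\<mm>\<close> for all \<open>t\<close>, then so would be the
  coefficients of the form \<open>det (X C + Y D)\<close>, and \<open>det B\<close> would lie in \<open>\<mm>\<^sup>n\<^sup>+\<^sup>1\<close>. For a \<open>t\<close> with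
  \<open>det (C + t D)\<close> a unit take \<open>y = a\<close> and \<open>x = b - t a\<close>: modulo \<open>x\<close> the matrix \<open>B\<close> is \<open>y\<close> times an
  invertible one.\<close>

lemma transversal_parameter:
  fixes B :: "'a::comm_ring_1 mat"
  assumes loc: "local_ring \<mm>" and inf: "infinite (residue_ring \<mm>)" and gen: "\<mm> = ideal_gen {a, b}"
    and B: "B \<in> carrier_mat n n" "\<And>i j. i < n \<Longrightarrow> j < n \<Longrightarrow> B $$ (i, j) \<in> \<mm>"
    and det: "det B \<notin> ideal_power \<mm> (Suc n)"
  obtains x y C U where "\<mm> = ideal_gen {x, y}" "C \<in> carrier_mat n n" "U \<in> carrier_mat n n"
    "B * C = y \<cdot>\<^sub>m 1\<^sub>m n + x \<cdot>\<^sub>m U"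
proof -
  have idm: "is_ideal \<mm>"
    using local_ring_maximal loc by blast
  have ab: "a \<in> \<mm>" "b \<in> \<mm>"
    by (simp_all add: gen ideal.span_base)
  have "\<forall>i j. \<exists>p q. i < n \<and> j < n \<longrightarrow> B $$ (i, j) = p * a + q * b"
    using B(2) by (auto simp: gen ideal_gen_pair)
  then obtain p q where pq: "\<And>i j. i < n \<Longrightarrow> j < n \<Longrightarrow> B $$ (i, j) = p i j * a + q i j * b"
    by metis
  define C D where "C = mat n n (\<lambda>(i, j). p i j)" and "D = mat n n (\<lambda>(i, j). q i j)"
  have CD: "C \<in> carrier_mat n n" "D \<in> carrier_mat n n"
    by (simp_all add: C_def D_def)
  have BCD: "B = a \<cdot>\<^sub>m C + b \<cdot>\<^sub>m D"
    using B(1) pq by (intro eq_matI) (auto simp: C_def D_def mult.commute)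
  have "\<exists>t. det (C + t \<cdot>\<^sub>m D) \<notin> \<mm>"
  proof (rule ccontr)
    assume "\<nexists>t. det (C + t \<cdot>\<^sub>m D) \<notin> \<mm>"
    then have vals: "poly (pencil_poly C D) t \<in> \<mm>" for t
      by (simp add: poly_pencil_poly[OF CD])
    obtain T where "finite T" "card T = Suc n" "\<forall>s\<in>T. \<forall>t\<in>T. s \<noteq> t \<longrightarrow> s - t \<notin> \<mm>"
      using exists_incongruent_elements[OF inf idm] by blast
    then have coeffs: "coeff (pencil_poly C D) k \<in> \<mm>" for k
      using coeffs_in_maximal_ideal[OF loc, of T "pencil_poly C D" k] vals
        degree_pencil_poly[OF CD(1), of D] by auto
    have "coeff (pencil_poly C D) k * a ^ (n - k) * b ^ k \<in> ideal_power \<mm> (Suc n)" if "k \<le> n" for k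
    proof -
      have "a ^ (n - k) * (b ^ k * 1) \<in> ideal_power \<mm> ((n - k) + (k + 0))"
        by (intro power_mult_in_ideal_power ab) simp
      then show ?thesis
        using mult_in_ideal_power[OF coeffs, of "a ^ (n - k) * b ^ k" n k] that
        by (simp add: mult.assoc del: ideal_power.simps)
    qed
    then show False
      using det unfolding BCD det_pencil[OF CD]
      by (meson ideal.subspace_sum[OF is_ideal_power] atMost_iff)
  qed
  then obtain t where "det (C + t \<cdot>\<^sub>m D) \<notin> \<mm>"
    by blast
  then obtain d where d: "det (C + t \<cdot>\<^sub>m D) * d = 1"
    using local_ring_unit loc by blast
  define G where "G = C + t \<cdot>\<^sub>m D"
  define H where "H = d \<cdot>\<^sub>m adj_mat G"
  have G: "G \<in> carrier_mat n n"
    using CD by (simp add: G_def)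
  have H: "H \<in> carrier_mat n n"
    using adj_mat(1)[OF G] by (simp add: H_def)
  have "G * H = d \<cdot>\<^sub>m (det G \<cdot>\<^sub>m 1\<^sub>m n)"
    unfolding H_def using adj_mat(1,2)[OF G] G by (simp add: mult_smult_distrib)
  also have "\<dots> = 1\<^sub>m n"
    using d by (intro eq_matI) (auto simp: G_def mult.commute)
  finally have GH: "G * H = 1\<^sub>m n" .
  have "B = a \<cdot>\<^sub>m G + (b - t * a) \<cdot>\<^sub>m D"
    unfolding BCD G_def using CD by (intro eq_matI) (auto simp: algebra_simps)
  then have "B * H = a \<cdot>\<^sub>m (G * H) + (b - t * a) \<cdot>\<^sub>m (D * H)"
    using G H CD by (simp add: add_mult_distrib_mat[of _ n n] mult_smult_assoc_mat[of _ n n])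
  then have eq: "B * H = a \<cdot>\<^sub>m 1\<^sub>m n + (b - t * a) \<cdot>\<^sub>m (D * H)"
    by (simp add: GH)
  have "\<mm> = ideal_gen {b - t * a, a}"
  proof -
    have "p * a + q * b = q * (b - t * a) + (p + q * t) * a"
      "p * (b - t * a) + q * a = (q - p * t) * a + p * b" for p q
      by (simp_all add: algebra_simps)
    then show ?thesis
      unfolding gen ideal_gen_pair by (auto; metis)
  qed
  then show thesis
    using that[OF _ H _ eq] CD H by simp
qed

text \<open>Suppose that \<open>x v\<close> is in the module only for \<open>v\<close> with entries in \<open>\<mm>\<close>. Because \<open>W\<close> is \<open>y\<close> modulo
  \<open>x\<close>, every column of \<open>A\<close> is \<open>W q + x v\<close> for such a \<open>v\<close>. As \<open>W\<close> has entries in \<open>\<mm>\<close>, the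
  terms \<open>x v\<close> change a maximal minor only by an element of \<open>\<mm>\<^sup>r\<^sup>+\<^sup>1\<close>, and what remains is a
  multiple of \<open>det W\<close>; so the image of the ideal of minors has dimension at most one.\<close>

lemma exists_colon_element:
  fixes A :: "'a::comm_ring_1 mat"
  assumes idm: "is_ideal \<mm>" "1 \<notin> \<mm>" and gen: "\<mm> = ideal_gen {x, y}"
    and A: "A \<in> carrier_mat r n" "\<And>i j. i < r \<Longrightarrow> j < n \<Longrightarrow> A $$ (i, j) \<in> \<mm>"
    and U: "U \<in> carrier_mat r r" and W: "W = y \<cdot>\<^sub>m 1\<^sub>m r + x \<cdot>\<^sub>m U"
    and cols: "\<And>j. j < r \<Longrightarrow> col W j \<in> column_module A"
    and dim: "image_has_dim \<mm> (ideal_power \<mm> (Suc r)) (minors_ideal A) d" "2 \<le> d"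
  obtains e i where "e \<in> carrier_vec r" "i < r" "e $ i \<notin> \<mm>" "x \<cdot>\<^sub>v e \<in> column_module A"
proof -
  have xy: "x \<in> \<mm>" "y \<in> \<mm>"
    by (simp_all add: gen ideal.span_base)
  have Wc: "W \<in> carrier_mat r r"
    using U by (simp add: W)
  have Wm: "W $$ (i, j) \<in> \<mm>" if "i < r" "j < r" for i j
    using that U xy by (auto simp: W intro!: ideal.subspace_add[OF idm(1)] ideal_mult_right[OF idm(1)])
  have False if H: "\<And>e i. e \<in> carrier_vec r \<Longrightarrow> x \<cdot>\<^sub>v e \<in> column_module A \<Longrightarrow> i < r \<Longrightarrow> e $ i \<in> \<mm>"
  proof -
    have split: "\<exists>q v. q \<in> carrier_vec r \<and> v \<in> carrier_vec r \<and> (\<forall>i<r. v $ i \<in> \<mm>) \<and>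
        w = W *\<^sub>v q + x \<cdot>\<^sub>v v" if w: "w \<in> column_module A" for w
    proof -
      have wc: "w \<in> carrier_vec r"
        using w A(1) by (auto simp: column_module_def)
      have "\<forall>i. \<exists>p q. i < r \<longrightarrow> w $ i = p * x + q * y"
        using column_module_entries[OF idm(1) A w] by (auto simp: gen ideal_gen_pair)
      then obtain p q where pq: "\<And>i. i < r \<Longrightarrow> w $ i = p i * x + q i * y"
        by metis
      (* w = x p + y q, and y q = W q - x U q. *)
      define c v where "c = vec r q" and "v = vec r p - U *\<^sub>v c"
      have c: "c \<in> carrier_vec r" and v: "v \<in> carrier_vec r"
        using U by (simp_all add: c_def v_def)
      have "W *\<^sub>v c = y \<cdot>\<^sub>v c + x \<cdot>\<^sub>v (U *\<^sub>v c)"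
      proof -
        have "(y \<cdot>\<^sub>m 1\<^sub>m r) *\<^sub>v c = y \<cdot>\<^sub>v c" "(x \<cdot>\<^sub>m U) *\<^sub>v c = x \<cdot>\<^sub>v (U *\<^sub>v c)"
          using U c by (auto simp: smult_mat_mult_vec[of _ r r])
        then show ?thesis
          unfolding W using U c by (subst add_mult_distrib_mat_vec[of _ r r]) auto
      qed
      then have eq: "w = W *\<^sub>v c + x \<cdot>\<^sub>v v"
        using U wc c pq by (intro eq_vecI) (auto simp: v_def algebra_simps c_def)
      then have "x \<cdot>\<^sub>v v = w - W *\<^sub>v c"
        using wc Wc c v by (intro eq_vecI) auto
      then have "x \<cdot>\<^sub>v v \<in> column_module A"
        using column_module_diff[OF w mult_mat_vec_in_column_module[OF A(1) Wc cols c]] by simp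
      then show ?thesis
        using H v c eq by blast
    qed
    define I' where "I' = {g. \<exists>c. g - c * det W \<in> ideal_power \<mm> (Suc r)}"
    have "det (submatrix A UNIV J) \<in> I'" if J: "J \<subseteq> {..<dim_col A}" "card J = dim_row A" for J
    proof -
      define B where "B = submatrix A UNIV J"
      have B: "B \<in> carrier_mat r r" and "\<And>j. j < r \<Longrightarrow> col B j \<in> column_module A"
        using maximal_minor_columns[OF J] A(1) by (auto simp: B_def)
      then have "\<forall>j. \<exists>q v. j < r \<longrightarrow> q \<in> carrier_vec r \<and> v \<in> carrier_vec r \<and> (\<forall>i<r. v $ i \<in> \<mm>) \<and>
          col B j = W *\<^sub>v q + x \<cdot>\<^sub>v v"
        using split by meson
      then obtain q v where qv: "\<And>j. j < r \<Longrightarrow> q j \<in> carrier_vec r \<and> v j \<in> carrier_vec r \<and>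
          (\<forall>i<r. v j $ i \<in> \<mm>) \<and> col B j = W *\<^sub>v q j + x \<cdot>\<^sub>v v j"
        by metis
      define Q V where "Q = mat r r (\<lambda>(i, j). q j $ i)" and "V = mat r r (\<lambda>(i, j). v j $ i)"
      have QV: "Q \<in> carrier_mat r r" "V \<in> carrier_mat r r"
        by (simp_all add: Q_def V_def)
      have "col Q j = q j" "col V j = v j" if "j < r" for j
        using that qv[OF that] by (auto simp: Q_def V_def)
      then have "col B j = col (W * Q + x \<cdot>\<^sub>m V) j" if "j < r" for j
        using that qv QV Wc by (simp add: col_mult2[of _ r r] col_add[of _ r r] col_smult)
      then have BWQ: "B = W * Q + x \<cdot>\<^sub>m V"
        using B Wc QV by (intro mat_col_eqI) auto
      have "(W * Q) $$ (i, j) \<in> \<mm>" if "i < r" "j < r" for i j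
        using that Wc QV Wm
        by (auto simp: scalar_prod_def intro!: ideal.subspace_sum[OF idm(1)] ideal_mult_right[OF idm(1)])
      then have "det B - det (W * Q) \<in> ideal_power \<mm> (Suc r)"
        unfolding BWQ using qv Wc QV xy(1)
        by (intro det_perturbation_in_ideal_power[OF idm(1)]) (auto simp: V_def)
      then show ?thesis
        unfolding I'_def B_def[symmetric] using det_mult[OF Wc QV(1)]
        by (auto intro!: exI[of _ "det Q"] simp: mult.commute simp del: ideal_power.simps)
    qed
    moreover have "is_ideal I'"
    proof (rule ideal.subspaceI)
      show "0 \<in> I'"
        using ideal.subspace_0[OF is_ideal_power] by (auto simp: I'_def intro!: exI[of _ 0] simp del: ideal_power.simps)
    next
      fix g h assume "g \<in> I'" "h \<in> I'"
      then obtain c c' where "g - c * det W \<in> ideal_power \<mm> (Suc r)" "h - c' * det W \<in> ideal_power \<mm> (Suc r)"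
        by (auto simp: I'_def simp del: ideal_power.simps)
      then have "(g - c * det W) + (h - c' * det W) \<in> ideal_power \<mm> (Suc r)"
        by (rule ideal.subspace_add[OF is_ideal_power])
      then show "g + h \<in> I'"
        by (auto simp: I'_def algebra_simps intro!: exI[of _ "c + c'"] simp del: ideal_power.simps)
    next
      fix a g assume "g \<in> I'"
      then obtain c where "g - c * det W \<in> ideal_power \<mm> (Suc r)"
        by (auto simp: I'_def simp del: ideal_power.simps)
      then have "a * (g - c * det W) \<in> ideal_power \<mm> (Suc r)"
        by (rule ideal.subspace_scale[OF is_ideal_power])
      then show "a * g \<in> I'"
        by (auto simp: I'_def algebra_simps intro!: exI[of _ "a * c"] simp del: ideal_power.simps)
    qed
    ultimately have I: "minors_ideal A \<subseteq> I'"
      unfolding minors_ideal_def by (intro ideal.span_minimal) auto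
    (* Two basis elements of the image are f 0 = c det W and f 1 = c' det W up to elements of the
       power. So c' f 0 - c f 1 is in the power and c is in \<mm>; but then f 0 is in the power. *)
    obtain f where f: "\<And>i. i < d \<Longrightarrow> f i \<in> minors_ideal A"
      and indep: "\<And>c. (\<Sum>i<d. c i * f i) \<in> ideal_power \<mm> (Suc r) \<Longrightarrow> \<forall>i<d. c i \<in> \<mm>"
      using dim(1) by (auto simp: image_has_dim_def simp del: ideal_power.simps)
    have indep2: "c \<in> \<mm> \<and> c' \<in> \<mm>" if "c * f 0 + c' * f 1 \<in> ideal_power \<mm> (Suc r)" for c c'
    proof -
      define a where "a = (\<lambda>i::nat. if i = 0 then c else if i = 1 then c' else 0)"
      have "(\<Sum>i<d. a i * f i) = (\<Sum>i\<in>{0, 1}. a i * f i)"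
        using dim(2) by (intro sum.mono_neutral_right) (auto simp: a_def)
      also have "\<dots> = c * f 0 + c' * f 1"
        by (simp add: a_def)
      finally have "\<forall>i<d. a i \<in> \<mm>"
        using that indep by metis
      moreover have "0 < d" "1 < d"
        using dim(2) by auto
      ultimately have "a 0 \<in> \<mm>" "a 1 \<in> \<mm>"
        by blast+
      then show ?thesis
        by (simp add: a_def)
    qed
    have "f 0 \<in> I'" "f 1 \<in> I'"
      using I f[of 0] f[of 1] dim(2) by auto
    then obtain c c' where c: "f 0 - c * det W \<in> ideal_power \<mm> (Suc r)"
      and c': "f 1 - c' * det W \<in> ideal_power \<mm> (Suc r)"
      unfolding I'_def by blast
    have "c' * (f 0 - c * det W) - c * (f 1 - c' * det W) \<in> ideal_power \<mm> (Suc r)"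
      using c c' ideal.subspace_diff[OF is_ideal_power] ideal.subspace_scale[OF is_ideal_power] by blast
    moreover have "c' * (f 0 - c * det W) - c * (f 1 - c' * det W) = c' * f 0 + (- c) * f 1"
      by (simp add: algebra_simps)
    ultimately have "- c \<in> \<mm>"
      using indep2 by metis
    then have "c \<in> \<mm>"
      using ideal.subspace_neg[OF idm(1), of "- c"] by simp
    then have "c * det W \<in> ideal_power \<mm> (Suc r)"
      using mult_in_ideal_power det_in_ideal_power[OF Wc Wm] by blast
    then have "(f 0 - c * det W) + c * det W \<in> ideal_power \<mm> (Suc r)"
      by (rule ideal.subspace_add[OF is_ideal_power c])
    then have "1 \<in> \<mm>"
      using indep2[of 1 0] by (simp del: ideal_power.simps)
    then show False
      using idm(2) by simp
  qed
  then show thesis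
    using that by blast
qed

section \<open>Valuations\<close>

text \<open>The contraction to \<open>R\<close> of the \<open>k\<close>-th power of the maximal ideal of the valuation ring. The
  zero element is included by hand because \<open>v 0\<close> is arbitrary.\<close>

definition value_ideal :: "('a::idom fract \<Rightarrow> int) \<Rightarrow> int \<Rightarrow> 'a set" where
  "value_ideal v k = {a. a = 0 \<or> k \<le> v (to_fract a)}"

lemma to_fract_power: "to_fract (a ^ n) = to_fract a ^ n"
  by (induction n) simp_all

lemma discrete_valuation_1: "discrete_valuation v \<Longrightarrow> v 1 = 0"
  unfolding discrete_valuation_def by (metis add_cancel_right_left mult_1 zero_neq_one)

lemma discrete_valuation_mult:
  "discrete_valuation v \<Longrightarrow> x \<noteq> 0 \<Longrightarrow> y \<noteq> 0 \<Longrightarrow> v (x * y) = v x + v y"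
  by (simp add: discrete_valuation_def)

lemma discrete_valuation_divide:
  "discrete_valuation v \<Longrightarrow> x \<noteq> 0 \<Longrightarrow> y \<noteq> 0 \<Longrightarrow> v (x / y) = v x - v y"
  using discrete_valuation_mult[of v "x / y" y] by simp

lemma mult_in_value_ideal:
  assumes "discrete_valuation v" "a \<in> value_ideal v k" "b \<in> value_ideal v l"
  shows "a * b \<in> value_ideal v (k + l)"
  using assms discrete_valuation_mult[of v "to_fract a" "to_fract b"]
  by (cases "a = 0 \<or> b = 0") (auto simp: value_ideal_def)

lemma is_ideal_value_ideal:
  assumes v: "discrete_valuation v" and R: "\<And>a. a \<in> value_ideal v 0"
  shows "is_ideal (value_ideal v k)"
proof (rule ideal.subspaceI)
  show "a + b \<in> value_ideal v k" if "a \<in> value_ideal v k" "b \<in> value_ideal v k" for a b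
  proof (cases "a = 0 \<or> b = 0 \<or> a + b = 0")
    case False
    then have "to_fract a + to_fract b \<noteq> 0"
      by (metis to_fract_add to_fract_eq_0_iff)
    then have "min (v (to_fract a)) (v (to_fract b)) \<le> v (to_fract a + to_fract b)"
      using v False by (simp add: discrete_valuation_def)
    then show ?thesis
      using that False by (auto simp: value_ideal_def)
  qed (use that in \<open>auto simp: value_ideal_def\<close>)
  show "c * a \<in> value_ideal v k" if "a \<in> value_ideal v k" for c a
    using mult_in_value_ideal[OF v R that, of c] by simp
qed (simp add: value_ideal_def)

lemma ideal_power_subset_value_ideal:
  assumes v: "discrete_valuation v" and R: "\<And>a. a \<in> value_ideal v 0" and J: "J \<subseteq> value_ideal v k"
  shows "ideal_power J n \<subseteq> value_ideal v (int n * k)"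
proof (induction n)
  case (Suc n)
  have "a * b \<in> value_ideal v (int (Suc n) * k)" if "a \<in> J" "b \<in> ideal_power J n" for a b
    using mult_in_value_ideal[OF v, of a k b "int n * k"] that J Suc by (auto simp: algebra_simps)
  then have "{a * b |a b. a \<in> J \<and> b \<in> ideal_power J n} \<subseteq> value_ideal v (int (Suc n) * k)"
    by blast
  then show ?case
    unfolding ideal_power.simps by (rule ideal.span_minimal[OF _ is_ideal_value_ideal[OF v R]])
qed (use R in auto)

lemma valuation_power:
  assumes "discrete_valuation v" "x \<noteq> 0"
  shows "v (x ^ n) = int n * v x"
  using assms by (induction n)
    (simp_all add: discrete_valuation_1 discrete_valuation_mult algebra_simps)

text \<open>As a form in \<open>y\<close> and \<open>x\<close> the determinant is \<open>y^r\<close> plus terms divisible by \<open>x\<close>, and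
  those have a greater value than \<open>y^r\<close>.\<close>

lemma valuation_det_le:
  assumes v: "discrete_valuation v" and R: "\<And>a. a \<in> value_ideal v 0"
    and y: "y \<noteq> 0" and x: "x \<in> value_ideal v (v (to_fract y) + 1)"
    and U: "U \<in> carrier_mat r r"
  shows "det (y \<cdot>\<^sub>m 1\<^sub>m r + x \<cdot>\<^sub>m U) \<notin> value_ideal v (int r * v (to_fract y) + 1)"
proof
  define J where "J = value_ideal v (int r * v (to_fract y) + 1)"
  define p where "p = pencil_poly (1\<^sub>m r) U"
  assume det: "det (y \<cdot>\<^sub>m 1\<^sub>m r + x \<cdot>\<^sub>m U) \<in> value_ideal v (int r * v (to_fract y) + 1)"
  have idJ: "is_ideal J"
    unfolding J_def by (rule is_ideal_value_ideal[OF v R])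
  have yv: "y ^ n \<in> value_ideal v (int n * v (to_fract y))" for n
    using y valuation_power[OF v, of "to_fract y" n] by (simp add: value_ideal_def to_fract_power)
  have xv: "x ^ k \<in> value_ideal v (int k * (v (to_fract y) + 1))" for k
  proof (induction k)
    case (Suc k)
    have "v (to_fract y) + 1 + int k * (v (to_fract y) + 1) = int (Suc k) * (v (to_fract y) + 1)"
      by (simp add: algebra_simps)
    then show ?case
      using mult_in_value_ideal[OF v x Suc] by simp
  qed (simp add: R)
  define S where "S = (\<Sum>k\<in>{1..r}. coeff p k * (y ^ (r - k) * x ^ k))"
  have S: "S \<in> J"
    unfolding S_def
  proof (rule ideal.subspace_sum[OF idJ], rule ideal.subspace_scale[OF idJ])
    fix k assume k: "k \<in> {1..r}"
    have "y ^ (r - k) * x ^ k \<in> value_ideal v (int r * v (to_fract y) + int k)"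
      using mult_in_value_ideal[OF v yv[of "r - k"] xv[of k]] k by (simp add: algebra_simps of_nat_diff)
    then show "y ^ (r - k) * x ^ k \<in> J"
      using k by (auto simp: J_def value_ideal_def)
  qed
  have "det (y \<cdot>\<^sub>m 1\<^sub>m r + x \<cdot>\<^sub>m U) = y ^ r + S"
  proof -
    have "1\<^sub>m r + 0 \<cdot>\<^sub>m U = 1\<^sub>m r"
      using U by (intro eq_matI) auto
    then have p0: "coeff p 0 = 1"
      using poly_pencil_poly[OF one_carrier_mat U, of 0] by (simp add: p_def poly_0_coeff_0)
    have "{..r} = insert 0 {1..r}"
      by auto
    then show ?thesis
      unfolding det_pencil[OF one_carrier_mat U] p_def[symmetric]
      by (simp add: p0 mult.assoc S_def)
  qed
  then have "y ^ r \<in> J"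
    using ideal.subspace_diff[OF idJ det[folded J_def] S] by simp
  then have "int r * v (to_fract y) + 1 \<le> v (to_fract y ^ r)"
    using y by (simp add: J_def value_ideal_def to_fract_power)
  then show False
    using valuation_power[OF v, of "to_fract y" r] y by simp
qed

text \<open>The case that matters is \<open>v x > v y\<close>: then \<open>W / y\<close> is invertible over \<open>V\<close>, and the coefficients
  that express \<open>y e\<close> by the columns of \<open>W\<close> come from Cramer's rule. They lie in \<open>V\<close> because \<open>y\<close>
  times a cofactor of \<open>W\<close> is in \<open>\<mm>\<^sup>r\<close>, while \<open>det W\<close> has value at most \<open>r v y\<close>.\<close>

lemma in_ring_span_colon_element:
  assumes V: "dvr_between V" and gen: "\<mm> = ideal_gen {x, y}"
    and U: "U \<in> carrier_mat r r" and W: "W = y \<cdot>\<^sub>m 1\<^sub>m r + x \<cdot>\<^sub>m U"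
    and cols: "\<And>j. j < r \<Longrightarrow> col W j \<in> M"
    and e: "e \<in> carrier_vec r" "x \<cdot>\<^sub>v e \<in> M"
  shows "in_ring_span r M V (y \<cdot>\<^sub>v e)"
proof -
  obtain v where v: "discrete_valuation v" and Vv: "V = {x. x = 0 \<or> 0 \<le> v x}"
    and RV: "range to_fract \<subseteq> V"
    using V by (auto simp: dvr_between_def)
  have R: "a \<in> value_ideal v 0" for a
    using RV by (auto simp: Vv value_ideal_def image_subset_iff)
  consider "y = 0" | "y \<noteq> 0" "x \<noteq> 0" "v (to_fract x) \<le> v (to_fract y)"
    | "y \<noteq> 0" "x \<in> value_ideal v (v (to_fract y) + 1)"
    by (force simp: value_ideal_def)
  then show ?thesis
  proof cases
    case 1
    (* The vector is 0, so the empty combination represents it. *)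
    then show ?thesis
      using e(1) by (auto simp: in_ring_span_def intro!: exI[of _ "0::nat"])
  next
    case 2
    then have "to_fract y / to_fract x \<in> V"
      using discrete_valuation_divide[OF v, of "to_fract y" "to_fract x"] by (simp add: Vv)
    then show ?thesis
      unfolding in_ring_span_def using e 2
      by (intro exI[of _ 1] exI[of _ "\<lambda>_. to_fract y / to_fract x"] exI[of _ "\<lambda>_. x \<cdot>\<^sub>v e"]) auto
  next
    case 3
    have Wc: "W \<in> carrier_mat r r"
      using U by (simp add: W)
    define D where "D = to_fract (det W)"
    have "det W \<notin> value_ideal v (int r * v (to_fract y) + 1)"
      unfolding W using valuation_det_le[OF v R 3(1,2) U] .
    then have D: "D \<noteq> 0" "v D \<le> int r * v (to_fract y)"
      by (auto simp: D_def value_ideal_def)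
    have m: "\<mm> \<subseteq> value_ideal v (v (to_fract y))"
      unfolding gen using 3
      by (intro ideal.span_minimal is_ideal_value_ideal[OF v R]) (auto simp: value_ideal_def)
    have idm: "is_ideal \<mm>" "x \<in> \<mm>" "y \<in> \<mm>"
      by (simp_all add: gen ideal.span_base)
    have Wm: "W $$ (i, j) \<in> \<mm>" if "i < r" "j < r" for i j
      using that U idm
      by (auto simp: W intro!: ideal.subspace_add[OF idm(1)] ideal_mult_right[OF idm(1)])
    define g where "g = adj_mat W *\<^sub>v (y \<cdot>\<^sub>v e)"
    have adj: "adj_mat W \<in> carrier_mat r r"
      using adj_mat(1)[OF Wc] .
    then have g: "g \<in> carrier_vec r"
      using e(1) by (simp add: g_def)
    have Wg: "W *\<^sub>v g = det W \<cdot>\<^sub>v (y \<cdot>\<^sub>v e)"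
      unfolding g_def using e(1) assoc_mult_mat_vec[OF Wc adj, of "y \<cdot>\<^sub>v e"] adj_mat(2)[OF Wc]
      by (simp add: smult_mat_mult_vec[of _ r r])
    have "g $ j \<in> value_ideal v (int r * v (to_fract y))" if j: "j < r" for j
    proof -
      have "y * adj_mat W $$ (j, i) \<in> ideal_power \<mm> r" if i: "i < r" for i
      proof -
        have "det (mat_delete W i j) \<in> ideal_power \<mm> (r - 1)"
        proof (rule det_in_ideal_power)
          show "mat_delete W i j \<in> carrier_mat (r - 1) (r - 1)"
            using Wc by (auto simp: mat_delete_def)
          show "mat_delete W i j $$ (i', j') \<in> \<mm>" if "i' < r - 1" "j' < r - 1" for i' j'
            using that Wc by (auto simp: mat_delete_def intro!: Wm)
        qed
        then have "y * ((- 1) ^ (i + j) * det (mat_delete W i j)) \<in> ideal_power \<mm> (Suc (r - 1))"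
          by (intro mult_in_ideal_power ideal.subspace_scale[OF is_ideal_power])
            (simp_all add: gen ideal.span_base)
        then show ?thesis
          using i j Wc by (simp add: adj_mat_def cofactor_def del: ideal_power.simps)
      qed
      then have "(\<Sum>i = 0..<r. y * adj_mat W $$ (j, i) * e $ i) \<in> ideal_power \<mm> r"
        by (intro ideal.subspace_sum[OF is_ideal_power]) (simp add: ideal_mult_right[OF is_ideal_power])
      moreover have "g $ j = (\<Sum>i = 0..<r. y * adj_mat W $$ (j, i) * e $ i)"
        using j adj e(1) by (auto simp: g_def scalar_prod_def ac_simps intro!: sum.cong)
      ultimately show ?thesis
        using ideal_power_subset_value_ideal[OF v R m, of r] by auto
    qed
    then have "to_fract (g $ j) / D \<in> V" if "j < r" for j
      using that D discrete_valuation_divide[OF v, of "to_fract (g $ j)" D]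
      by (force simp: Vv value_ideal_def)
    moreover have "to_fract ((y \<cdot>\<^sub>v e) $ i) = (\<Sum>j<r. to_fract (g $ j) / D * to_fract (col W j $ i))"
      if i: "i < r" for i
    proof -
      have "D * to_fract ((y \<cdot>\<^sub>v e) $ i) = to_fract ((W *\<^sub>v g) $ i)"
        using i e(1) by (simp add: Wg D_def)
      also have "\<dots> = (\<Sum>j<r. to_fract (g $ j) * to_fract (col W j $ i))"
        using i Wc g by (auto simp: scalar_prod_def atLeast0LessThan mult.commute intro!: sum.cong)
      finally show ?thesis
        using D(1) by (simp add: field_simps flip: sum_divide_distrib)
    qed
    ultimately show ?thesis
      unfolding in_ring_span_def using cols
      by (intro exI[of _ r] exI[of _ "\<lambda>j. to_fract (g $ j) / D"] exI[of _ "col W"]) simp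
  qed
qed

section \<open>The double dual\<close>

lemma dual_iff:
  assumes "Modules.module scale"
  shows "f \<in> dual scale \<longleftrightarrow> (\<forall>x y. f (x + y) = f x + f y) \<and> (\<forall>c x. f (scale c x) = c * f x)"
  using assms by (simp add: dual_def module_hom_iff module_mult)

lemma to_bidual_in_bidual:
  assumes "Modules.module scale"
  shows "to_bidual scale z \<in> bidual scale"
proof -
  have "f + g \<in> dual scale" "fun_scale c f \<in> dual scale" if "f \<in> dual scale" "g \<in> dual scale" for c f g
    using that by (simp_all add: dual_iff[OF assms] fun_scale_def algebra_simps)
  then show ?thesis
    by (auto simp: bidual_def to_bidual_def fun_scale_def)
qed

definition coordinate_embedding ::
  "('a::comm_ring_1 \<Rightarrow> 'm::ab_group_add \<Rightarrow> 'm) \<Rightarrow> ((('m \<Rightarrow> 'a) \<Rightarrow> 'a) \<Rightarrow> 'a vec) \<Rightarrow> 'm \<Rightarrow> 'a vec" where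
  "coordinate_embedding scale \<phi> z = \<phi> (to_bidual scale z)"

lemma embedded_module_eq_range: "embedded_module scale \<phi> = range (coordinate_embedding scale \<phi>)"
  by (simp add: embedded_module_def coordinate_embedding_def)

lemma coordinate_embedding:
  assumes M: "Modules.module scale" and \<phi>: "bidual_coordinates scale r \<phi>"
  shows "coordinate_embedding scale \<phi> z \<in> carrier_vec r"
    and "coordinate_embedding scale \<phi> (z + w) = coordinate_embedding scale \<phi> z + coordinate_embedding scale \<phi> w"
    and "coordinate_embedding scale \<phi> (scale c z) = c \<cdot>\<^sub>v coordinate_embedding scale \<phi> z"
proof -
  have bij: "bij_betw \<phi> (bidual scale) (carrier_vec r)"
    and add: "\<And>u v. u \<in> bidual scale \<Longrightarrow> v \<in> bidual scale \<Longrightarrow> \<phi> (u + v) = \<phi> u + \<phi> v"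
    and smult: "\<And>c u. u \<in> bidual scale \<Longrightarrow> \<phi> (fun_scale c u) = c \<cdot>\<^sub>v \<phi> u"
    using \<phi> by (auto simp: bidual_coordinates_def linear_iso_def)
  note bd = to_bidual_in_bidual[OF M]
  show "coordinate_embedding scale \<phi> z \<in> carrier_vec r"
    using bij_betw_apply[OF bij bd] by (simp add: coordinate_embedding_def)
  have "to_bidual scale (z + w) = to_bidual scale z + to_bidual scale w"
    by (auto simp: to_bidual_def dual_iff[OF M])
  then show "coordinate_embedding scale \<phi> (z + w) =
      coordinate_embedding scale \<phi> z + coordinate_embedding scale \<phi> w"
    using add bd by (simp add: coordinate_embedding_def)
  have "to_bidual scale (scale c z) = fun_scale c (to_bidual scale z)"
    by (auto simp: to_bidual_def fun_scale_def dual_iff[OF M])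
  then show "coordinate_embedding scale \<phi> (scale c z) = c \<cdot>\<^sub>v coordinate_embedding scale \<phi> z"
    using smult bd by (simp add: coordinate_embedding_def)
qed

text \<open>A maximal independent set \<open>B\<close> spans a free submodule that contains \<open>d M\<close> for some \<open>d \<noteq> 0\<close>.
  The coordinates of \<open>d z\<close> with respect to \<open>B\<close> are linear forms in \<open>z\<close>, and together they
  determine \<open>d z\<close>, hence \<open>z\<close>.\<close>

lemma inj_to_bidual:
  fixes scale :: "'a::idom \<Rightarrow> 'm::ab_group_add \<Rightarrow> 'm"
  assumes M: "Modules.module scale" and fg: "finitely_generated scale"
    and tf: "torsion_free scale" and rank: "has_rank scale r"
  shows "inj (to_bidual scale)"
proof (rule injI)
  fix z w assume eq: "to_bidual scale z = to_bidual scale w"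
  interpret M: Modules.module scale
    by (rule M)
  obtain B where B: "finite B" "card B = r" "M.independent B"
    and max: "\<And>C. finite C \<Longrightarrow> M.independent C \<Longrightarrow> card C \<le> r"
    using rank by (auto simp: has_rank_def)
  have ex1: "\<exists>d. d \<noteq> 0 \<and> scale d z \<in> M.span B" for z
  proof (cases "z \<in> B")
    case True
    then show ?thesis
      using M.span_base by (intro exI[of _ 1]) auto
  next
    case False
    then have "M.dependent (insert z B)"
      using max[of "insert z B"] B by auto
    then obtain u where u: "\<exists>v\<in>insert z B. u v \<noteq> 0" "(\<Sum>v\<in>insert z B. scale (u v) v) = 0"
      using B(1) by (auto simp: M.dependent_finite)
    have s: "scale (u z) z + (\<Sum>v\<in>B. scale (u v) v) = 0"
      using u(2) B(1) False by simp
    have "u z \<noteq> 0"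
    proof
      assume "u z = 0"
      then have "M.dependent B"
        using s u(1) B(1) by (auto simp: M.dependent_finite)
      then show False
        using B(3) by simp
    qed
    moreover have "scale (u z) z = - (\<Sum>v\<in>B. scale (u v) v)"
      using s by (simp add: eq_neg_iff_add_eq_0)
    then have "scale (u z) z \<in> M.span B"
      by (simp add: M.span_neg M.span_sum M.span_scale M.span_base)
    ultimately show ?thesis
      by blast
  qed
  obtain S where S: "finite S" "M.span S = UNIV"
    using fg by (auto simp: finitely_generated_def)
  have "\<exists>d. d \<noteq> 0 \<and> (\<forall>z\<in>S. scale d z \<in> M.span B)"
    using S(1)
  proof (induction S rule: finite_induct)
    case (insert z S)
    obtain d d' where "d \<noteq> 0" "\<forall>z\<in>S. scale d z \<in> M.span B" "d' \<noteq> 0" "scale d' z \<in> M.span B"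
      using insert.IH ex1 by blast
    then have "d' * d \<noteq> 0" "\<forall>z\<in>S. scale (d' * d) z \<in> M.span B" "scale (d * d') z \<in> M.span B"
      using M.span_scale by (simp_all flip: M.scale_scale)
    then show ?case
      by (intro exI[of _ "d' * d"]) (auto simp: mult.commute)
  qed (auto intro: exI[of _ 1])
  then obtain d where d: "d \<noteq> 0" and dS: "\<And>z. z \<in> S \<Longrightarrow> scale d z \<in> M.span B"
    by blast
  have dz: "scale d z \<in> M.span B" for z
  proof -
    have "M.span S \<subseteq> {z. scale d z \<in> M.span B}"
    proof (rule M.span_minimal)
      show "M.subspace {z. scale d z \<in> M.span B}"
      proof (rule M.subspaceI)
        fix c z assume "z \<in> {z. scale d z \<in> M.span B}"
        then have "scale c (scale d z) \<in> M.span B"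
          by (simp only: mem_Collect_eq M.span_scale)
        then show "scale c z \<in> {z. scale d z \<in> M.span B}"
          by (simp add: mult.commute)
      qed (auto simp: M.scale_right_distrib M.span_add M.span_zero)
    qed (use dS in auto)
    then show ?thesis
      using S(2) by auto
  qed
  have form: "(\<lambda>z. M.representation B (scale d z) b) \<in> dual scale" for b
    by (simp add: dual_iff[OF M] M.scale_right_distrib M.representation_add[OF B(3) dz dz]
        M.scale_left_commute[of d] M.representation_scale[OF B(3) dz] del: M.scale_scale)
  have "f z = f w" if "f \<in> dual scale" for f
    using fun_cong[OF eq, of f] that by (simp add: to_bidual_def)
  then have reps: "M.representation B (scale d z) b = M.representation B (scale d w) b" for b
    using form by blast
  have "scale d z = (\<Sum>b\<in>B. scale (M.representation B (scale d z) b) b)"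
    by (rule M.sum_representation_eq[OF B(3) dz B(1) order_refl, symmetric])
  also have "\<dots> = (\<Sum>b\<in>B. scale (M.representation B (scale d w) b) b)"
    by (simp only: reps)
  also have "\<dots> = scale d w"
    by (rule M.sum_representation_eq[OF B(3) dz B(1) order_refl])
  finally have "scale d z = scale d w" .
  then have "scale d (z - w) = 0"
    by (simp add: M.scale_right_diff_distrib)
  then have "z - w = 0"
    using tf d unfolding torsion_free_def by blast
  then show "z = w"
    by simp
qed

lemma inj_coordinate_embedding:
  assumes "Modules.module scale" "bidual_coordinates scale r \<phi>" "inj (to_bidual scale)"
  shows "inj (coordinate_embedding scale \<phi>)"
proof -
  have "inj_on \<phi> (bidual scale)"
    using assms(2) by (auto simp: bidual_coordinates_def linear_iso_def bij_betw_def)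
  then show ?thesis
    using assms(3) to_bidual_in_bidual[OF assms(1)]
    by (auto simp: inj_def inj_on_def coordinate_embedding_def)
qed

lemma linear_form_expansion:
  fixes g :: "'a::comm_ring_1 vec \<Rightarrow> 'a"
  assumes add: "\<And>u w. u \<in> carrier_vec r \<Longrightarrow> w \<in> carrier_vec r \<Longrightarrow> g (u + w) = g u + g w"
    and smult: "\<And>c u. u \<in> carrier_vec r \<Longrightarrow> g (c \<cdot>\<^sub>v u) = c * g u"
    and x: "x \<in> carrier_vec r"
  shows "g x = (\<Sum>k<r. x $ k * g (unit_vec r k))"
proof -
  (* The truncations of x; they build x from the zero vector by adding one coordinate at a time. *)
  define t where "t = (\<lambda>n. vec r (\<lambda>k. if k < n then x $ k else 0))"
  have "n \<le> r \<Longrightarrow> g (t n) = (\<Sum>k<n. x $ k * g (unit_vec r k))" for n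
  proof (induction n)
    case 0
    have "t 0 = 0 \<cdot>\<^sub>v x"
      using x by (auto simp: t_def)
    then show ?case
      using smult[OF x, of 0] by simp
  next
    case (Suc n)
    have "t (Suc n) = t n + x $ n \<cdot>\<^sub>v unit_vec r n"
      using Suc.prems by (auto simp: t_def less_Suc_eq)
    then show ?case
      using Suc add[of "t n" "x $ n \<cdot>\<^sub>v unit_vec r n"] smult[of "unit_vec r n" "x $ n"]
      by (simp add: t_def)
  qed
  moreover have "t r = x"
    using x by (auto simp: t_def)
  ultimately show ?thesis
    by auto
qed

lemma in_ring_span_linear_image:
  fixes T :: "'a::idom vec \<Rightarrow> 'a vec"
  assumes T: "\<And>u. u \<in> carrier_vec r \<Longrightarrow> T u \<in> carrier_vec r"
    and add: "\<And>u w. u \<in> carrier_vec r \<Longrightarrow> w \<in> carrier_vec r \<Longrightarrow> T (u + w) = T u + T w"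
    and smult: "\<And>c u. u \<in> carrier_vec r \<Longrightarrow> T (c \<cdot>\<^sub>v u) = c \<cdot>\<^sub>v T u"
    and M: "M \<subseteq> carrier_vec r" "\<And>u. u \<in> M \<Longrightarrow> T u \<in> M'"
    and x: "x \<in> carrier_vec r" "in_ring_span r M V x"
  shows "in_ring_span r M' V (T x)"
proof -
  obtain n c w where w: "\<And>j. j < n \<Longrightarrow> c j \<in> V \<and> w j \<in> M"
    and xw: "\<And>i. i < r \<Longrightarrow> to_fract (x $ i) = (\<Sum>j<n::nat. c j * to_fract (w j $ i))"
    using x(2) by (auto simp: in_ring_span_def)
  have exp: "T u $ i = (\<Sum>k<r. u $ k * T (unit_vec r k) $ i)" if "u \<in> carrier_vec r" "i < r" for u i
  proof (rule linear_form_expansion[of r "\<lambda>u. T u $ i"])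
    fix u w :: "'a vec" assume "u \<in> carrier_vec r" "w \<in> carrier_vec r"
    then show "T (u + w) $ i = T u $ i + T w $ i"
      using add T[of u] T[of w] that(2) by simp
  next
    fix c and u :: "'a vec" assume "u \<in> carrier_vec r"
    then show "T (c \<cdot>\<^sub>v u) $ i = c * T u $ i"
      using smult T[of u] that(2) by simp
  qed (use that in simp)
  have "to_fract (T x $ i) = (\<Sum>j<n. c j * to_fract (T (w j) $ i))" if i: "i < r" for i
  proof -
    have "to_fract (T x $ i) = (\<Sum>k<r. \<Sum>j<n. c j * to_fract (w j $ k) * to_fract (T (unit_vec r k) $ i))"
      by (simp add: exp[OF x(1) i] xw sum_distrib_right)
    also have "\<dots> = (\<Sum>j<n. \<Sum>k<r. c j * to_fract (w j $ k) * to_fract (T (unit_vec r k) $ i))"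
      by (rule sum.swap)
    also have "\<dots> = (\<Sum>j<n. c j * to_fract (T (w j) $ i))"
    proof (rule sum.cong[OF refl])
      fix j assume "j \<in> {..<n}"
      then have "w j \<in> carrier_vec r"
        using w M(1) by auto
      then show "(\<Sum>k<r. c j * to_fract (w j $ k) * to_fract (T (unit_vec r k) $ i)) =
          c j * to_fract (T (w j) $ i)"
        by (subst exp[OF _ i]) (simp_all add: sum_distrib_left mult.assoc)
    qed
    finally show ?thesis .
  qed
  then show ?thesis
    unfolding in_ring_span_def using w M(2)
    by (intro exI[of _ n] exI[of _ c] exI[of _ "\<lambda>j. T (w j)"]) simp
qed

text \<open>Being integrally closed does not depend on the identification of \<open>M\<^sup>*\<^sup>*\<close> with \<open>R\<^sup>r\<close>: two of
  them differ by a linear automorphism, which carries one \<open>V\<close>-span of \<open>M\<close> into the other. The ideal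
  of minors and the integral closure of \<open>M\<close> can therefore be computed in the same coordinates.\<close>

lemma integrally_closed_module_coordinates:
  assumes M: "Modules.module scale" and closed: "integrally_closed_module scale r"
    and \<phi>: "bidual_coordinates scale r \<phi>"
    and x: "x \<in> carrier_vec r" "integral_over_module r (embedded_module scale \<phi>) x"
  shows "x \<in> embedded_module scale \<phi>"
proof -
  obtain \<phi>' where \<phi>': "bidual_coordinates scale r \<phi>'"
    and cl: "\<And>x. x \<in> carrier_vec r \<Longrightarrow> integral_over_module r (embedded_module scale \<phi>') x \<Longrightarrow>
      x \<in> embedded_module scale \<phi>'"
    using closed by (auto simp: integrally_closed_module_def)
  define \<theta> where "\<theta> = inv_into (bidual scale) \<phi>"
  have bij: "bij_betw \<phi> (bidual scale) (carrier_vec r)" "bij_betw \<phi>' (bidual scale) (carrier_vec r)"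
    and add: "\<And>u v. u \<in> bidual scale \<Longrightarrow> v \<in> bidual scale \<Longrightarrow> \<phi> (u + v) = \<phi> u + \<phi> v"
    and smult: "\<And>c u. u \<in> bidual scale \<Longrightarrow> \<phi> (fun_scale c u) = c \<cdot>\<^sub>v \<phi> u"
    and add': "\<And>u v. u \<in> bidual scale \<Longrightarrow> v \<in> bidual scale \<Longrightarrow> \<phi>' (u + v) = \<phi>' u + \<phi>' v"
    and smult': "\<And>c u. u \<in> bidual scale \<Longrightarrow> \<phi>' (fun_scale c u) = c \<cdot>\<^sub>v \<phi>' u"
    using \<phi> \<phi>' by (auto simp: bidual_coordinates_def linear_iso_def)
  have \<theta>: "\<theta> u \<in> bidual scale" "\<phi> (\<theta> u) = u" if "u \<in> carrier_vec r" for u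
    using that bij(1) by (auto simp: \<theta>_def bij_betw_def inv_into_into f_inv_into_f)
  have \<theta>\<phi>: "\<theta> (\<phi> F) = F" if "F \<in> bidual scale" for F
    using that bij(1) by (simp add: \<theta>_def bij_betw_def)
  have closed_bd: "F + G \<in> bidual scale" "fun_scale c F \<in> bidual scale"
    if "F \<in> bidual scale" "G \<in> bidual scale" for c F G
    using that by (auto simp: bidual_def fun_scale_def algebra_simps)
  have \<theta>_add: "\<theta> (u + w) = \<theta> u + \<theta> w" if "u \<in> carrier_vec r" "w \<in> carrier_vec r" for u w
    using \<theta>\<phi>[of "\<theta> u + \<theta> w"] add[of "\<theta> u" "\<theta> w"] \<theta>[OF that(1)] \<theta>[OF that(2)] closed_bd by simp
  have \<theta>_smult: "\<theta> (c \<cdot>\<^sub>v u) = fun_scale c (\<theta> u)" if "u \<in> carrier_vec r" for c u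
    using \<theta>\<phi>[of "fun_scale c (\<theta> u)"] smult[of "\<theta> u" c] \<theta>[OF that] closed_bd by simp
  have \<phi>'\<theta>: "\<phi>' (\<theta> u) \<in> carrier_vec r" if "u \<in> carrier_vec r" for u
    using bij_betw_apply[OF bij(2)] \<theta>(1)[OF that] by blast
  have "in_ring_span r (embedded_module scale \<phi>') V (\<phi>' (\<theta> x))" if "dvr_between V" for V
  proof (rule in_ring_span_linear_image[of r "\<lambda>u. \<phi>' (\<theta> u)" "embedded_module scale \<phi>"])
    show "in_ring_span r (embedded_module scale \<phi>) V x"
      using x(2) that by (simp add: integral_over_module_def)
    show "embedded_module scale \<phi> \<subseteq> carrier_vec r"
      using coordinate_embedding(1)[OF M \<phi>] by (auto simp: embedded_module_eq_range)
    show "\<phi>' (\<theta> u) \<in> embedded_module scale \<phi>'" if "u \<in> embedded_module scale \<phi>" for u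
      using that \<theta>\<phi> to_bidual_in_bidual[OF M] by (auto simp: embedded_module_def)
  qed (simp_all add: x(1) \<phi>'\<theta> \<theta>_add \<theta>_smult add' smult' \<theta>)
  then have "\<phi>' (\<theta> x) \<in> embedded_module scale \<phi>'"
    using cl \<phi>'\<theta>[OF x(1)] by (simp add: integral_over_module_def)
  then obtain z where "\<phi>' (\<theta> x) = \<phi>' (to_bidual scale z)"
    by (auto simp: embedded_module_def)
  then have "\<theta> x = to_bidual scale z"
    using bij(2) \<theta>(1)[OF x(1)] to_bidual_in_bidual[OF M] by (auto simp: bij_betw_def dest: inj_onD)
  then show ?thesis
    using \<theta>(2)[OF x(1)] by (auto simp: embedded_module_def)
qed

section \<open>Direct summands\<close>

text \<open>If \<open>f z\<close> is a unit, then \<open>M\<close> is the direct sum of \<open>R z\<close>, which is free, and the kernel of \<open>f\<close>.\<close>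

lemma linear_form_in_maximal_ideal:
  fixes scale :: "'a::idom \<Rightarrow> 'm::ab_group_add \<Rightarrow> 'm"
  assumes M: "Modules.module scale" and tf: "torsion_free scale"
    and nofree: "without_free_summands scale" and loc: "local_ring \<mm>" and f: "f \<in> dual scale"
  shows "f z \<in> \<mm>"
proof (rule ccontr)
  assume fz: "f z \<notin> \<mm>"
  interpret M: Modules.module scale
    by (rule M)
  have add: "\<And>x y. f (x + y) = f x + f y" and smult: "\<And>c x. f (scale c x) = c * f x"
    using f by (simp_all add: dual_iff[OF M])
  obtain c where c: "f z * c = 1"
    using local_ring_unit[OF loc fz] by blast
  have fdiff: "f (x - y) = f x - f y" for x y
    using add[of "x - y" y] by simp
  have f0: "f 0 = 0"
    using fdiff[of 0 0] by simp
  have z0: "z \<noteq> 0"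
    using c f0 by auto
  define N where "N = {w. f w = 0}"
  have indep: "M.independent {z}"
    using tf z0 by (auto simp: M.dependent_finite torsion_free_def)
  have "M.subspace N"
    by (rule M.subspaceI) (simp_all add: N_def add smult f0)
  moreover have "M.span {z} \<inter> N = {0}"
  proof -
    have "a = 0" if "f (scale a z) = 0" for a
      using that c by (auto simp: smult)
    then have "M.span {z} \<inter> N \<subseteq> {0}"
      using M.scale_zero_left by (fastforce simp: M.span_singleton N_def)
    then show ?thesis
      using f0 M.span_zero by (auto simp: N_def)
  qed
  moreover have "w \<in> {a + n |a n. a \<in> M.span {z} \<and> n \<in> N}" for w
  proof -
    have "f (w - scale (f w * c) z) = f w - f w * (f z * c)"
      by (simp add: fdiff smult ac_simps)
    then have "w - scale (f w * c) z \<in> N"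
      by (simp add: N_def c)
    moreover have "scale (f w * c) z \<in> M.span {z}"
      by (simp add: M.span_scale M.span_base)
    moreover have "w = scale (f w * c) z + (w - scale (f w * c) z)"
      by simp
    ultimately show ?thesis
      by blast
  qed
  ultimately have "internal_direct_sum scale (M.span {z}) N"
    by (auto simp: internal_direct_sum_def M.subspace_span)
  moreover have "free_submodule scale (M.span {z})"
    using indep by (auto simp: free_submodule_def)
  moreover have "M.span {z} \<noteq> {0}"
    using z0 M.span_base[of z "{z}"] by auto
  ultimately show False
    using nofree by (auto simp: without_free_summands_def)
qed

text \<open>The complement of the image of the section \<open>g\<close> is the kernel of \<open>f\<close>.\<close>

lemma direct_summand_of_section:
  fixes scale :: "'a::comm_ring_1 \<Rightarrow> 'm::ab_group_add \<Rightarrow> 'm"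
  assumes M: "Modules.module scale" and J: "is_ideal J"
    and f: "f \<in> dual scale" "\<And>z. f z \<in> J"
    and g_add: "\<And>a b. a \<in> J \<Longrightarrow> b \<in> J \<Longrightarrow> g (a + b) = g a + g b"
    and g_scale: "\<And>c a. a \<in> J \<Longrightarrow> g (c * a) = scale c (g a)"
    and fg: "\<And>a. a \<in> J \<Longrightarrow> f (g a) = a"
  shows "\<exists>N \<psi>. Modules.module.subspace scale N \<and>
    linear_iso (prod_scale (*) scale) (J \<times> N) scale UNIV \<psi>"
proof (intro exI conjI)
  interpret M: Modules.module scale
    by (rule M)
  have add: "\<And>x y. f (x + y) = f x + f y" and smult: "\<And>c x. f (scale c x) = c * f x"
    using f(1) by (simp_all add: dual_iff[OF M])
  have fdiff: "f (x - y) = f x - f y" for x y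
    using add[of "x - y" y] by simp
  define N where "N = {w. f w = 0}"
  define \<psi> where "\<psi> = (\<lambda>(a, n). g a + n)"
  show "M.subspace N"
    using fdiff[of 0 0] by (intro M.subspaceI) (simp_all add: N_def add smult)
  have "bij_betw \<psi> (J \<times> N) UNIV"
    by (rule bij_betw_byWitness[where f' = "\<lambda>z. (f z, z - g (f z))"])
      (auto simp: \<psi>_def N_def add fdiff fg f(2))
  then show "linear_iso (prod_scale (*) scale) (J \<times> N) scale UNIV \<psi>"
    unfolding linear_iso_def
    by (auto simp: \<psi>_def prod_scale_def g_add g_scale M.scale_right_distrib)
qed

section \<open>The maximal ideal as a direct summand\<close>

theorem proposition20:
  fixes \<mm> I :: "'a::idom set"
    and r :: nat
    and scale :: "'a \<Rightarrow> 'm::ab_group_add \<Rightarrow> 'm"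
  assumes "regular_local_ring \<mm> 2"
    and "infinite (residue_ring \<mm>)"
    and "integrally_closed_ideal I"
    and "has_ideal_order \<mm> I r"
    and "\<exists>d\<ge>2. image_has_dim \<mm> (ideal_power \<mm> (Suc r)) I d"
    and "Modules.module scale"
    and "finitely_generated scale"
    and "torsion_free scale"
    and "has_rank scale r"
    and "integrally_closed_module scale r"
    and "without_free_summands scale"
    and "is_ideal_of_minors scale r I"
  shows "\<exists>N \<psi>. Modules.module.subspace scale N \<and>
           linear_iso (prod_scale (*) scale) (\<mm> \<times> N) scale UNIV \<psi>"
proof -
  note M = assms(6)
  have loc: "local_ring \<mm>" and "\<exists>S. finite S \<and> card S = 2 \<and> ideal_gen S = \<mm>"
    using assms(1) by (auto simp: regular_local_ring_def)
  then obtain a b where gen_ab: "\<mm> = ideal_gen {a, b}"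
    by (auto simp: card_2_iff)
  have idm: "is_ideal \<mm>" "1 \<notin> \<mm>"
    using local_ring_maximal[OF loc] by auto
  obtain \<phi> A where \<phi>: "bidual_coordinates scale r \<phi>" and dimA: "dim_row A = r"
    and colA: "column_module A = embedded_module scale \<phi>" and I: "I = minors_ideal A"
    using assms(12) by (auto simp: is_ideal_of_minors_def)
  define j where "j = coordinate_embedding scale \<phi>"
  have j: "j z \<in> carrier_vec r" "j (z + w) = j z + j w" "j (scale c z) = c \<cdot>\<^sub>v j z" for z w c
    using coordinate_embedding[OF M \<phi>] by (simp_all add: j_def)
  have range_j: "column_module A = range j"
    by (simp add: colA embedded_module_eq_range j_def)
  have inj_j: "inj j"
    unfolding j_def by (rule inj_coordinate_embedding[OF M \<phi> inj_to_bidual[OF M assms(7-9)]])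
  have coord: "(\<lambda>z. c * j z $ i) \<in> dual scale" if "i < r" for c i
    using that by (simp add: dual_iff[OF M] j(2,3) carrier_vecD[OF j(1)] algebra_simps)
  have form_in: "c * j z $ i \<in> \<mm>" if "i < r" for c z i
    using linear_form_in_maximal_ideal[OF M assms(8,11) loc coord[OF that]] .
  have A: "A \<in> carrier_mat r (dim_col A)"
    using dimA by auto
  have Am: "A $$ (i, k) \<in> \<mm>" if ik: "i < r" "k < dim_col A" for i k
  proof -
    obtain z where "col A k = j z"
      using col_in_column_module[OF ik(2)] range_j by auto
    then show ?thesis
      using form_in[OF ik(1), of 1 z] ik dimA by (metis col_def index_vec mult_1)
  qed
  have "\<not> I \<subseteq> ideal_power \<mm> (Suc r)"
    using assms(4) by (auto simp: has_ideal_order_def simp del: ideal_power.simps)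
  then have "\<not> {det (submatrix A UNIV J) |J. J \<subseteq> {..<dim_col A} \<and> card J = dim_row A}
      \<subseteq> ideal_power \<mm> (Suc r)"
    unfolding I minors_ideal_def by (meson ideal.span_minimal is_ideal_power)
  then obtain J where J: "J \<subseteq> {..<dim_col A}" "card J = dim_row A"
    and detJ: "det (submatrix A UNIV J) \<notin> ideal_power \<mm> (Suc r)"
    unfolding subset_iff mem_Collect_eq by metis
  define B where "B = submatrix A UNIV J"
  have B: "B \<in> carrier_mat r r" and colB: "\<And>k. k < r \<Longrightarrow> col B k \<in> column_module A"
    using maximal_minor_columns[OF J] by (auto simp: B_def dimA)
  have Bm: "B $$ (i, k) \<in> \<mm>" if "i < r" "k < r" for i k
    using column_module_entries[OF idm(1) A Am colB[OF that(2)] that(1)] that B by simp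
  obtain x y C U where gen: "\<mm> = ideal_gen {x, y}" and C: "C \<in> carrier_mat r r"
    and U: "U \<in> carrier_mat r r" and BC: "B * C = y \<cdot>\<^sub>m 1\<^sub>m r + x \<cdot>\<^sub>m U"
    using transversal_parameter[OF loc assms(2) gen_ab B Bm detJ[folded B_def]] by blast
  define W where "W = B * C"
  have colW: "col W k \<in> column_module A" if "k < r" for k
    using mult_mat_vec_in_column_module[OF A B colB, of "col C k"] that col_mult2[OF B C that] C
    by (simp add: W_def)
  obtain d where d: "image_has_dim \<mm> (ideal_power \<mm> (Suc r)) (minors_ideal A) d" "2 \<le> d"
    using assms(5) I by blast
  obtain e i where e: "e \<in> carrier_vec r" and i: "i < r" "e $ i \<notin> \<mm>"
    and xe: "x \<cdot>\<^sub>v e \<in> column_module A"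
    using exists_colon_element[OF idm gen A Am U BC[folded W_def] colW d] by blast
  have "integral_over_module r (column_module A) (y \<cdot>\<^sub>v e)"
    unfolding integral_over_module_def
    using in_ring_span_colon_element[OF _ gen U BC[folded W_def] colW e xe] by blast
  then have ye: "y \<cdot>\<^sub>v e \<in> column_module A"
    using integrally_closed_module_coordinates[OF M assms(10) \<phi>, of "y \<cdot>\<^sub>v e"] e colA by simp
  obtain c where c: "e $ i * c = 1"
    using local_ring_unit[OF loc i(2)] by blast
  (* The form c times the i-th coordinate takes the value 1 at e, and multiplication by e is its
     section. *)
  define g where "g = (\<lambda>a. inv_into UNIV j (a \<cdot>\<^sub>v e))"
  have jg: "j (g a) = a \<cdot>\<^sub>v e" if a: "a \<in> \<mm>" for a
  proof -
    obtain p q where pq: "a = p * x + q * y"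
      using a by (auto simp: gen ideal_gen_pair)
    obtain u w where "x \<cdot>\<^sub>v e = j u" "y \<cdot>\<^sub>v e = j w"
      using xe ye range_j by auto
    then have "a \<cdot>\<^sub>v e = j (scale p u + scale q w)"
      by (simp add: j(2,3) pq add_smult_distrib_vec flip: smult_smult_assoc)
    then show ?thesis
      unfolding g_def by (metis f_inv_into_f rangeI)
  qed
  show ?thesis
  proof (rule direct_summand_of_section[OF M idm(1) coord[OF i(1), of c] form_in[OF i(1)]])
    fix a b assume ab: "a \<in> \<mm>" "b \<in> \<mm>"
    then have "j (g (a + b)) = j (g a + g b)"
      using ideal.subspace_add[OF idm(1)] by (simp add: jg j(2) add_smult_distrib_vec)
    then show "g (a + b) = g a + g b"
      by (rule injD[OF inj_j])
  next
    fix d a assume a: "a \<in> \<mm>"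
    then have "j (g (d * a)) = j (scale d (g a))"
      using ideal.subspace_scale[OF idm(1)] by (simp add: jg j(3) smult_smult_assoc)
    then show "g (d * a) = scale d (g a)"
      by (rule injD[OF inj_j])
  next
    fix a assume "a \<in> \<mm>"
    then show "c * j (g a) $ i = a"
      using e i(1) c by (simp add: jg) (metis mult.commute mult.left_commute mult_1_right)
  qed
qed

end
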